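(* Let $D$ be a formally self-adjoint, conformally covariant, polydifferential operator of rank $r$ and homogeneity $-2k\neq -n$ on $n$-manifolds. Given a compact Riemannian $n$-manifold $(M,g)$, define $\mathcal{F}^g : C^\infty(M)\setminus\{0\}\to\mathbb{R}$ by $$\mathcal{F}^g(u) := \frac{\mathfrak{D}^g(u^{\otimes r})}{\lVert u\rVert_{r^\ast}^{r}},$$ where $r^\ast := rn/(n-2k)$ and $\lVert\cdot\rVert_{r^\ast}$ denotes the $L^{r^\ast}$-norm. Then $u$ is a critical point of $\mathcal{F}^g$ if and only if $u$ solves $$D^g\bigl(u^{\otimes(r-1)}\bigr) = \left(\frac{n-2k}{r}\right)^{r-1}\lambda\,\lvert u\rvert^{\frac{(r-2)n+4k}{n-2k}}u$$ for some $\lambda\in\mathbb{R}$.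
   Context: All tensor products are over $\mathbb{R}$. A (natural) polydifferential operator of rank $\ell+1\in\mathbb{N}$ on $n$-manifolds is an assignment $D$ to each Riemannian $n$-manifold $(M,g)$ of a linear operator $D^g : C^\infty(M)^{\otimes \ell} \to C^\infty(M)$ such that $D^g(u_1\otimes\cdots\otimes u_\ell)$ is expressed by a universal (coefficients independent of $(M,g)$) $\mathbb{R}$-linear combination of complete contractions, formed with the inverse metric, of tensors $\nabla^{N_1}\mathrm{Rm}\otimes\cdots\otimes\nabla^{N_p}\mathrm{Rm}\otimes\nabla^{N_{p+1}}u_1\otimes\cdots\otimes\nabla^{N_{p+\ell}}u_\ell$, where $\mathrm{Rm}$ is the Riemann curvature tensor. $D$ has homogeneity $h$ if $D^{c^2g}=c^{h}D^g$ for all $(M,g)$ and all constants $c>0$; the homogeneity, when defined, is a nonpositive even integer, and it is written $-2k$. A formally self-adjoint, conformally covariant, polydifferential operator of rank $r\in\mathbb{N}$ on $n$-manifolds is a natural polydifferential operator $D$ of rank $r$ such that (1) the Dirichlet form $\mathfrak{D}^g(u_1\otimes\cdots\otimes u_r) := \int_M u_1 D^g(u_2\otimes\cdots\otimes u_r)\,dV_g$ on $C_0^\infty(M)^{\otimes r}$ (compactly supported smooth functions) is symmetric in $u_1,\dots,u_r$; and (2) there is a weight $w\in\mathbb{R}$ such that if $\hat g=e^{2\Upsilon}g$, then $\mathfrak{D}^{\hat g}(e^{w\Upsilon}u_1\otimes\cdots\otimes e^{w\Upsilon}u_r)=\mathfrak{D}^g(u_1\otimes\cdots\otimes u_r)$.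 If $D$ has homogeneity $-2k$, then $rw=2k-n$. A critical point of $\mathcal{F}^g$ is a $u\in C^\infty(M)\setminus\{0\}$ with $\frac{d}{dt}\big|_{t=0}\mathcal{F}^g(u+tv)=0$ for all $v\in C^\infty(M)$.
   Formalization: If n < 2k, or if r = 1 and k = 0 (the cases r* ≤ 1), u is assumed nowhere zero: at zeros of u the right-hand side of the equation is undefined, and for n < 2k the integral of |u|^{r*} may diverge (e.g. n = 3, k = 2, r = 2), so the functional is not defined there. *)

theory Defs
  imports "HOL-Analysis.Analysis" "HOL-Combinatorics.Permutations" "HOL-Library.Multiset"
begin

section \<open>Smooth manifolds\<close>

text \<open>Differentiability classes on an open subset \<open>U\<close> of a normed space.\<close>

primrec ck_on :: "nat \<Rightarrow> 'b::real_normed_vector set \<Rightarrow> ('b \<Rightarrow> 'c::real_normed_vector) \<Rightarrow> bool" where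
  "ck_on 0 U f \<longleftrightarrow> continuous_on U f"
| "ck_on (Suc k) U f \<longleftrightarrow>
     (\<forall>x\<in>U. f differentiable (at x)) \<and> (\<forall>v. ck_on k U (\<lambda>x. frechet_derivative f (at x) v))"

definition smooth_on :: "'b::real_normed_vector set \<Rightarrow> ('b \<Rightarrow> 'c::real_normed_vector) \<Rightarrow> bool" where
  "smooth_on U f \<longleftrightarrow> (\<forall>k. ck_on k U f)"

text \<open>A chart is a pair \<open>(U, \<phi>)\<close> of its domain and its coordinate map, of which only the values
  on \<open>U\<close> matter. A manifold of dimension \<open>CARD('n)\<close> is given by an atlas \<open>M\<close>; its points are
  the points covered by the charts, and its topology is the one the charts induce.\<close>

type_synonym ('a, 'n) chart = "'a set \<times> ('a \<Rightarrow> real^'n)"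

definition coord_dom :: "('a, 'n::finite) chart \<Rightarrow> (real^'n) set" where
  "coord_dom c = snd c ` fst c"

definition chart_inv :: "('a, 'n::finite) chart \<Rightarrow> real^'n \<Rightarrow> 'a" where
  "chart_inv c = inv_into (fst c) (snd c)"

definition points :: "('a, 'n::finite) chart set \<Rightarrow> 'a set" where
  "points M = (\<Union>c\<in>M. fst c)"

definition mtop :: "('a, 'n::finite) chart set \<Rightarrow> 'a topology" where
  "mtop M = topology (\<lambda>W. W \<subseteq> points M \<and> (\<forall>c\<in>M. open (snd c ` (W \<inter> fst c))))"

definition smooth_atlas :: "('a, 'n::finite) chart set \<Rightarrow> bool" where
  "smooth_atlas M \<longleftrightarrow>
     (\<forall>c\<in>M. inj_on (snd c) (fst c) \<and> open (coord_dom c)) \<and>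
     (\<forall>c\<in>M. \<forall>c'\<in>M. open (snd c ` (fst c \<inter> fst c')) \<and>
        smooth_on (snd c ` (fst c \<inter> fst c')) (snd c' \<circ> chart_inv c))"

lemma openin_mtop:
  assumes "smooth_atlas M"
  shows "openin (mtop M) W \<longleftrightarrow> W \<subseteq> points M \<and> (\<forall>c\<in>M. open (snd c ` (W \<inter> fst c)))"
proof -
  have "istopology (\<lambda>W. W \<subseteq> points M \<and> (\<forall>c\<in>M. open (snd c ` (W \<inter> fst c))))"
    unfolding istopology_def
  proof (intro conjI allI impI ballI)
    fix S T and c :: "('a, 'b) chart"
    assume S: "S \<subseteq> points M \<and> (\<forall>c\<in>M. open (snd c ` (S \<inter> fst c)))"
      and T: "T \<subseteq> points M \<and> (\<forall>c\<in>M. open (snd c ` (T \<inter> fst c)))" and c: "c \<in> M"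
    have "inj_on (snd c) (fst c)" using assms c by (auto simp: smooth_atlas_def)
    then have "snd c ` (S \<inter> T \<inter> fst c) = snd c ` (S \<inter> fst c) \<inter> snd c ` (T \<inter> fst c)"
      by (auto simp: inj_on_def image_iff; metis)
    then show "open (snd c ` (S \<inter> T \<inter> fst c))" using S T c by auto
  next
    fix K and c :: "('a, 'b) chart"
    assume K: "\<forall>S\<in>K. S \<subseteq> points M \<and> (\<forall>c\<in>M. open (snd c ` (S \<inter> fst c)))" and c: "c \<in> M"
    have "snd c ` (\<Union>K \<inter> fst c) = (\<Union>S\<in>K. snd c ` (S \<inter> fst c))" by blast
    then show "open (snd c ` (\<Union>K \<inter> fst c))" using K c by auto
  qed auto
  then show ?thesis by (simp add: mtop_def topology_inverse')
qed

definition smooth_manifold :: "('a, 'n::finite) chart set \<Rightarrow> bool" where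
  "smooth_manifold M \<longleftrightarrow>
     smooth_atlas M \<and> Hausdorff_space (mtop M) \<and> second_countable (mtop M)"

text \<open>Functions on a manifold are total functions on \<open>'a\<close>; only their values on \<open>points M\<close> matter.\<close>

definition smooth_fun :: "('a, 'n::finite) chart set \<Rightarrow> ('a \<Rightarrow> real) set" where
  "smooth_fun M = {u. \<forall>c\<in>M. smooth_on (coord_dom c) (u \<circ> chart_inv c)}"

definition smooth_fun_compact_supp :: "('a, 'n::finite) chart set \<Rightarrow> ('a \<Rightarrow> real) set" where
  "smooth_fun_compact_supp M =
     {u \<in> smooth_fun M. compactin (mtop M) (mtop M closure_of {p \<in> points M. u p \<noteq> 0})}"

section \<open>Riemannian metrics\<close>

text \<open>A metric is given by its matrix of components \<open>g c x\<close> in each chart \<open>c\<close>, as a function of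
  the coordinates \<open>x\<close>; the last clause is the transformation law of a covariant 2-tensor.\<close>

type_synonym ('a, 'n) metric_field = "('a, 'n) chart \<Rightarrow> real^'n \<Rightarrow> real^'n^'n"

definition riemannian_metric ::
  "('a, 'n::finite) chart set \<Rightarrow> ('a, 'n) metric_field \<Rightarrow> bool" where
  "riemannian_metric M g \<longleftrightarrow>
     (\<forall>c\<in>M. smooth_on (coord_dom c) (g c) \<and>
        (\<forall>x\<in>coord_dom c. transpose (g c x) = g c x \<and>
           (\<forall>v. v \<noteq> 0 \<longrightarrow> v \<bullet> (g c x *v v) > 0))) \<and>
     (\<forall>c\<in>M. \<forall>c'\<in>M. \<forall>x\<in>snd c ` (fst c \<inter> fst c').
        let f = snd c' \<circ> chart_inv c;
            J = matrix (frechet_derivative f (at x))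
        in g c x = transpose J ** g c' (f x) ** J)"

definition riemannian_manifold ::
  "('a, 'n::finite) chart set \<Rightarrow> ('a, 'n) metric_field \<Rightarrow> bool" where
  "riemannian_manifold M g \<longleftrightarrow> smooth_manifold M \<and> riemannian_metric M g"

definition scale_metric ::
  "('a \<Rightarrow> real) \<Rightarrow> ('a, 'n::finite) metric_field \<Rightarrow> ('a, 'n) metric_field" where
  "scale_metric \<rho> g = (\<lambda>c x. \<rho> (chart_inv c x) *\<^sub>R g c x)"

text \<open>The Riemannian measure \<open>dV\<^sub>g\<close>: the unique Borel measure which in every chart has density
  \<open>sqrt (det g)\<close> with respect to Lebesgue measure. Uniqueness holds because \<open>M\<close>, being second
  countable, is covered by countably many charts; existence by the change of variables formula.\<close>

definition riem_volume ::
  "('a, 'n::finite) chart set \<Rightarrow> ('a, 'n) metric_field \<Rightarrow> 'a measure" where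
  "riem_volume M g = (THE \<mu>.
     sets \<mu> = sets (sigma (points M) {W. openin (mtop M) W}) \<and>
     (\<forall>c\<in>M. \<forall>B\<in>sets \<mu>. B \<subseteq> fst c \<longrightarrow>
        emeasure \<mu> B = (\<integral>\<^sup>+x\<in>snd c ` B. ennreal (sqrt (det (g c x))) \<partial>lborel)))"

section \<open>Tensor calculus in coordinates\<close>

text \<open>Below, \<open>G\<close> is the component matrix of a metric on an open subset of coordinate space. A covariant
  tensor of rank \<open>m\<close> is given by its components, indexed by lists of length \<open>m\<close>.\<close>

type_synonym 'n ctensor = "'n list \<Rightarrow> real^'n \<Rightarrow> real"

definition partial :: "'n::finite \<Rightarrow> (real^'n \<Rightarrow> real) \<Rightarrow> real^'n \<Rightarrow> real" where
  "partial i f x = frechet_derivative f (at x) (axis i 1)"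

definition christoffel :: "(real^'n::finite \<Rightarrow> real^'n^'n) \<Rightarrow> 'n \<Rightarrow> 'n \<Rightarrow> 'n \<Rightarrow> real^'n \<Rightarrow> real" where
  "christoffel G k i j x =
     (\<Sum>l\<in>UNIV. matrix_inv (G x) $ k $ l *
        (partial i (\<lambda>y. G y $ j $ l) x + partial j (\<lambda>y. G y $ i $ l) x
          - partial l (\<lambda>y. G y $ i $ j) x)) / 2"

text \<open>The slot created by the covariant derivative is the first one.\<close>

definition cov_deriv :: "(real^'n::finite \<Rightarrow> real^'n^'n) \<Rightarrow> 'n ctensor \<Rightarrow> 'n ctensor" where
  "cov_deriv G T I x =
     (case I of
        [] \<Rightarrow> 0
      | a # J \<Rightarrow> partial a (T J) x
          - (\<Sum>s<length J. \<Sum>b\<in>UNIV. christoffel G b a (J ! s) x * T (J[s := b]) x))"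

text \<open>\<open>riemann G [i, j, k, l]\<close> is \<open>g (R(\<partial>\<^sub>i, \<partial>\<^sub>j) \<partial>\<^sub>k, \<partial>\<^sub>l)\<close>, where
  \<open>R(X, Y) = \<nabla>\<^sub>X \<nabla>\<^sub>Y - \<nabla>\<^sub>Y \<nabla>\<^sub>X - \<nabla>\<^bsub>[X, Y]\<^esub>\<close>.\<close>

definition riemann :: "(real^'n::finite \<Rightarrow> real^'n^'n) \<Rightarrow> 'n ctensor" where
  "riemann G I x =
     (let i = I ! 0; j = I ! 1; k = I ! 2; l = I ! 3 in
      \<Sum>m\<in>UNIV. G x $ m $ l *
        (partial i (christoffel G m j k) x - partial j (christoffel G m i k) x
         + (\<Sum>s\<in>UNIV. christoffel G m i s x * christoffel G s j k x
                      - christoffel G m j s x * christoffel G s i k x)))"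

text \<open>The tensor product of a list of tensors, each one paired with its rank.\<close>

fun tensor_prod :: "(nat \<times> 'n::finite ctensor) list \<Rightarrow> 'n ctensor" where
  "tensor_prod [] I x = 1"
| "tensor_prod ((m, T) # Ts) I x = T (take m I) x * tensor_prod Ts (drop m I) x"

text \<open>The complete contraction of a tensor of rank \<open>d\<close> (even) which pairs the slots \<open>\<pi> (2 s)\<close> and
  \<open>\<pi> (2 s + 1)\<close> by the inverse metric, for a permutation \<open>\<pi>\<close> of the slots.\<close>

definition complete_contraction ::
  "(real^'n::finite \<Rightarrow> real^'n^'n) \<Rightarrow> nat \<Rightarrow> (nat \<Rightarrow> nat) \<Rightarrow> 'n ctensor \<Rightarrow> real^'n \<Rightarrow> real" where
  "complete_contraction G d \<pi> T x =
     (\<Sum>I | length I = d.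
        (\<Prod>s < d div 2. matrix_inv (G x) $ (I ! \<pi> (2 * s)) $ (I ! \<pi> (2 * s + 1))) * T I x)"

section \<open>Natural polydifferential operators\<close>

text \<open>A term \<open>(a, Ns, Ks, \<pi>)\<close> stands for \<open>a\<close> times the complete contraction along \<open>\<pi>\<close> of
  \<open>\<nabla>\<^sup>N Rm \<otimes> \<dots> \<otimes> \<nabla>\<^sup>K u\<^sub>1 \<otimes> \<dots>\<close>, with \<open>N\<close> ranging over \<open>Ns\<close> and \<open>K\<close> over \<open>Ks\<close>.\<close>

type_synonym contraction_term = "real \<times> nat list \<times> nat list \<times> (nat \<Rightarrow> nat)"

definition total_rank :: "nat list \<Rightarrow> nat list \<Rightarrow> nat" where
  "total_rank Ns Ks = sum_list (map (\<lambda>N. N + 4) Ns) + sum_list Ks"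

fun valid_term :: "nat \<Rightarrow> contraction_term \<Rightarrow> bool" where
  "valid_term l (a, Ns, Ks, \<pi>) \<longleftrightarrow>
     length Ks = l \<and> even (total_rank Ns Ks) \<and> \<pi> permutes {..<total_rank Ns Ks}"

fun eval_term ::
  "(real^'n::finite \<Rightarrow> real^'n^'n) \<Rightarrow> (real^'n \<Rightarrow> real) list \<Rightarrow> contraction_term \<Rightarrow> real^'n \<Rightarrow> real"
where
  "eval_term G fs (a, Ns, Ks, \<pi>) x =
     a * complete_contraction G (total_rank Ns Ks) \<pi>
       (tensor_prod
         (map (\<lambda>N. (N + 4, (cov_deriv G ^^ N) (riemann G))) Ns @
          map2 (\<lambda>K f. (K, (cov_deriv G ^^ K) (\<lambda>_. f))) Ks fs)) x"

text \<open>An operator assigns to each Riemannian manifold an operator on lists of functions. A linear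
  map on the \<open>l\<close>-fold tensor power of \<open>smooth_fun M\<close> is the same as an \<open>l\<close>-linear map, here a
  map on lists of length \<open>l\<close>.\<close>

type_synonym ('a, 'n) operator =
  "('a, 'n) chart set \<Rightarrow> ('a, 'n) metric_field \<Rightarrow> ('a \<Rightarrow> real) list \<Rightarrow> 'a \<Rightarrow> real"

definition multilinear_operator ::
  "nat \<Rightarrow> ('a, 'n::finite) chart set \<Rightarrow> (('a \<Rightarrow> real) list \<Rightarrow> 'a \<Rightarrow> real) \<Rightarrow> bool" where
  "multilinear_operator l M L \<longleftrightarrow>
     (\<forall>us. length us = l \<and> set us \<subseteq> smooth_fun M \<longrightarrow>
        L us \<in> smooth_fun M \<and>
        (\<forall>i<l. \<forall>f\<in>smooth_fun M. \<forall>h\<in>smooth_fun M. \<forall>a b. \<forall>p\<in>points M.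
           L (us[i := (\<lambda>q. a * f q + b * h q)]) p
             = a * L (us[i := f]) p + b * L (us[i := h]) p))"

definition polydiff_op :: "nat \<Rightarrow> ('a, 'n::finite) operator \<Rightarrow> bool" where
  "polydiff_op r D \<longleftrightarrow> 1 \<le> r \<and>
     (\<forall>M g. riemannian_manifold M g \<longrightarrow> multilinear_operator (r - 1) M (D M g)) \<and>
     (\<exists>ts. (\<forall>t\<in>set ts. valid_term (r - 1) t) \<and>
        (\<forall>M g us. riemannian_manifold M g \<and> length us = r - 1 \<and> set us \<subseteq> smooth_fun M \<longrightarrow>
           (\<forall>c\<in>M. \<forall>p\<in>fst c.
              D M g us p =
                (\<Sum>t\<leftarrow>ts. eval_term (g c) (map (\<lambda>u. u \<circ> chart_inv c) us) t (snd c p)))))"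

definition has_homogeneity :: "nat \<Rightarrow> ('a, 'n::finite) operator \<Rightarrow> real \<Rightarrow> bool" where
  "has_homogeneity r D h \<longleftrightarrow>
     (\<forall>M g us a. riemannian_manifold M g \<and> length us = r - 1 \<and> set us \<subseteq> smooth_fun M \<and> 0 < a \<longrightarrow>
        (\<forall>p\<in>points M. D M (scale_metric (\<lambda>_. a\<^sup>2) g) us p = (a powr h) * D M g us p))"

definition dirichlet_form ::
  "('a, 'n::finite) operator \<Rightarrow> ('a, 'n) chart set \<Rightarrow> ('a, 'n) metric_field \<Rightarrow>
     ('a \<Rightarrow> real) list \<Rightarrow> real" where
  "dirichlet_form D M g us = (\<integral>p. hd us p * D M g (tl us) p \<partial>riem_volume M g)"

definition formally_self_adjoint :: "nat \<Rightarrow> ('a, 'n::finite) operator \<Rightarrow> bool" where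
  "formally_self_adjoint r D \<longleftrightarrow>
     (\<forall>M g us vs. riemannian_manifold M g \<and> length us = r \<and>
        set us \<subseteq> smooth_fun_compact_supp M \<and> mset vs = mset us \<longrightarrow>
        dirichlet_form D M g vs = dirichlet_form D M g us)"

definition conformally_covariant :: "nat \<Rightarrow> ('a, 'n::finite) operator \<Rightarrow> bool" where
  "conformally_covariant r D \<longleftrightarrow>
     (\<exists>w::real. \<forall>M g \<Upsilon> us. riemannian_manifold M g \<and> \<Upsilon> \<in> smooth_fun M \<and> length us = r \<and>
        set us \<subseteq> smooth_fun_compact_supp M \<longrightarrow>
        dirichlet_form D M (scale_metric (\<lambda>p. exp (2 * \<Upsilon> p)) g)
            (map (\<lambda>u p. exp (w * \<Upsilon> p) * u p) us)
          = dirichlet_form D M g us)"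

definition fsa_conf_cov_polydiff_op :: "nat \<Rightarrow> ('a, 'n::finite) operator \<Rightarrow> bool" where
  "fsa_conf_cov_polydiff_op r D \<longleftrightarrow>
     polydiff_op r D \<and> formally_self_adjoint r D \<and> conformally_covariant r D"

section \<open>The functional\<close>

definition Lp_norm ::
  "('a, 'n::finite) chart set \<Rightarrow> ('a, 'n) metric_field \<Rightarrow> real \<Rightarrow> ('a \<Rightarrow> real) \<Rightarrow> real" where
  "Lp_norm M g q u = (\<integral>p. \<bar>u p\<bar> powr q \<partial>riem_volume M g) powr (1 / q)"

text \<open>The functional \<open>\<F>\<^sup>g\<close> of an operator of rank \<open>r\<close> and homogeneity \<open>-2k\<close>.\<close>

definition functional ::
  "nat \<Rightarrow> nat \<Rightarrow> ('a, 'n::finite) operator \<Rightarrow> ('a, 'n) chart set \<Rightarrow> ('a, 'n) metric_field \<Rightarrow>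
     ('a \<Rightarrow> real) \<Rightarrow> real" where
  "functional r k D M g u =
     dirichlet_form D M g (replicate r u) /
     (Lp_norm M g (real r * real CARD('n) / (real CARD('n) - 2 * real k)) u) ^ r"

definition nonzero_smooth_fun :: "('a, 'n::finite) chart set \<Rightarrow> ('a \<Rightarrow> real) set" where
  "nonzero_smooth_fun M = {u \<in> smooth_fun M. \<exists>p\<in>points M. u p \<noteq> 0}"

definition critical_point ::
  "('a, 'n::finite) chart set \<Rightarrow> (('a \<Rightarrow> real) \<Rightarrow> real) \<Rightarrow> ('a \<Rightarrow> real) \<Rightarrow> bool" where
  "critical_point M F u \<longleftrightarrow>
     u \<in> nonzero_smooth_fun M \<and>
     (\<forall>v\<in>smooth_fun M. ((\<lambda>t. F (\<lambda>p. u p + t * v p)) has_real_derivative 0) (at 0))"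

end

(*
  Write q for the critical exponent, N = int |u|^q, w = D(u^(r-1)) and mu = DD(u^r) / N, where DD is
  the Dirichlet form. Symmetry and linearity of DD give DD((u + t v)^r)' = r int v w at t = 0, and
  differentiation under the integral gives N' = q int v |u|^(q-2) u. By the quotient rule the
  derivative of F at u in direction v is a nonzero multiple of int v (w - mu |u|^(q-2) u), so u is
  critical iff this vanishes for all smooth v. Instead of bump functions we test with
  v = w - mu P(u), which is smooth for every polynomial P: letting P approximate |x|^(q-2) x on the
  compact range of u, the integral of (w - mu |u|^(q-2) u)^2 is 0. Conversely, if
  w = kappa |u|^(q-2) u, pairing with u shows that kappa = mu.
*)
theory Submission
  imports Defs
begin

text \<open>Two obstacles shape the development. First, \<open>riem_volume\<close> is a definite
  description, so no integral against it can be evaluated before such a measure is known to exist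
  and to be unique. Consistency on chart overlaps is the change of variables formula for transition
  maps, and second countability allows countably many disjoint pieces of charts to be glued. Two
  properties of the result carry the analysis: nonempty open sets have positive volume, which turns
  a vanishing integral into pointwise equality, and a compact manifold has finite volume, so that
  constants are integrable bounds. Second, \<open>\<bar>x\<bar> powr q\<close> is continuously
  differentiable at 0 only if \<open>1 < q\<close>. This fails exactly when the dimension is below
  \<open>2 * k\<close>, where \<open>q\<close> is negative, or when \<open>r = 1\<close> and
  \<open>k = 0\<close>, where \<open>q = 1\<close>; then \<open>u\<close> is taken without zeros and
  the calculus is done off 0. Even for \<open>1 < q\<close> the function
  \<open>\<bar>x\<bar> powr (q - 2) * x\<close> may fail to be smooth, so the Euler-Lagrange
  expression is not itself an admissible test function.\<close>

section \<open>Change of variables over an arbitrary finite index type\<close>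

text \<open>The change of variables theorem of the library asks for a well-ordered index type, which
  the statement does not provide. The copy \<open>'a ranked\<close> of \<open>'a\<close> carries such an order.\<close>

datatype 'a ranked = Ranked (unranked: 'a)

lemma bij_Ranked: "bij Ranked"
  by (rule o_bij[of unranked]) (simp_all add: fun_eq_iff)

lemma UNIV_ranked: "UNIV = range Ranked"
  using bij_Ranked by (metis bij_is_surj)

lemma inv_Ranked: "inv Ranked = unranked"
  by (rule inj_imp_inv_eq) (simp_all add: bij_Ranked bij_is_inj)

instance ranked :: (finite) finite
  by standard (simp add: UNIV_ranked)

instantiation ranked :: (finite) linorder
begin

text \<open>The order is pulled back from the naturals along \<open>to_nat_on\<close>, a numbering
  of the finite type that is chosen and not canonical; nothing below depends on the choice.\<close>

definition "x \<le> y \<longleftrightarrow> to_nat_on UNIV (unranked x) \<le> to_nat_on UNIV (unranked y)"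
definition "x < y \<longleftrightarrow> to_nat_on UNIV (unranked x) < to_nat_on UNIV (unranked y)"

instance
proof
  fix x y :: "'a ranked"
  have "inj_on (to_nat_on UNIV) (UNIV :: 'a set)"
    by (intro inj_on_to_nat_on countable_finite finite)
  then show "x \<le> y \<Longrightarrow> y \<le> x \<Longrightarrow> x = y"
    by (auto simp: less_eq_ranked_def inj_on_eq_iff ranked.expand)
qed (auto simp: less_eq_ranked_def less_ranked_def)

end

instance ranked :: (finite) wellorder
proof -
  \<comment> \<open>A strict order is acyclic, and an acyclic relation on a finite type is
    wellfounded.\<close>
  have "wf {(x :: 'a ranked, y). x < y}"
    by (auto simp: trancl_def tranclp_less intro!: finite_acyclic_wf acyclicI)
  then show "OFCLASS('a ranked, wellorder_class)"
    by (rule wf_wellorderI) intro_classes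
qed

definition to_ranked :: "'c^'n::finite \<Rightarrow> 'c^'n ranked" where
  "to_ranked x = (\<chi> j. x $ unranked j)"

definition of_ranked :: "'c^'n ranked \<Rightarrow> 'c^'n::finite" where
  "of_ranked y = (\<chi> i. y $ Ranked i)"

lemma of_to_ranked [simp]: "of_ranked (to_ranked x) = x"
  by (simp add: of_ranked_def to_ranked_def vec_eq_iff)

lemma to_of_ranked [simp]: "to_ranked (of_ranked y) = y"
  by (simp add: of_ranked_def to_ranked_def vec_eq_iff)

lemma linear_to_ranked: "linear (to_ranked :: real^'n::finite \<Rightarrow> _)"
  by (rule linearI) (simp_all add: to_ranked_def vec_eq_iff)

lemma linear_of_ranked: "linear (of_ranked :: _ \<Rightarrow> real^'n::finite)"
  by (rule linearI) (simp_all add: of_ranked_def vec_eq_iff)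

lemma borel_measurable_ranked [measurable]:
  "(to_ranked :: real^'n::finite \<Rightarrow> _) \<in> borel_measurable borel"
  "(of_ranked :: _ \<Rightarrow> real^'n::finite) \<in> borel_measurable borel"
  by (intro borel_measurable_continuous_onI linear_continuous_on
      linear_conv_bounded_linear[THEN iffD1] linear_to_ranked linear_of_ranked)+

lemma to_ranked_axis: "to_ranked (axis i c) = axis (Ranked i) c"
  by (auto simp: to_ranked_def axis_def vec_eq_iff ranked.expand)

lemma of_ranked_axis: "of_ranked (axis j c) = axis (unranked j) c"
  by (metis of_to_ranked to_ranked_axis ranked.collapse)

lemma all_ranked: "(\<forall>j. P j) \<longleftrightarrow> (\<forall>i. P (Ranked i))"
  by (metis ranked.collapse)

lemma prod_ranked: "(\<Prod>j\<in>UNIV. f (unranked j)) = (\<Prod>i\<in>UNIV. f i)"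
  by (subst UNIV_ranked, subst prod.reindex) (use bij_Ranked in \<open>auto simp: bij_def\<close>)

text \<open>Lebesgue measure is determined by its values on boxes, and relabelling the axes turns a
  box into one with the same side lengths.\<close>

lemma lborel_ranked: "distr lborel borel (of_ranked :: _ \<Rightarrow> real^'n::finite) = lborel"
proof (rule lborel_eqI[symmetric])
  fix l u :: "real^'n"
  assume lu: "\<And>b. b \<in> Basis \<Longrightarrow> l \<bullet> b \<le> u \<bullet> b"
  have le: "l $ i \<le> u $ i" for i
    using lu[of "axis i 1"] by (auto simp: inner_axis axis_in_Basis_iff)
  have "of_ranked -` box l u = box (to_ranked l) (to_ranked u)"
    by (simp add: set_eq_iff mem_box_cart to_ranked_def of_ranked_def all_ranked)
  then have "emeasure (distr lborel borel of_ranked) (box l u)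
      = emeasure lborel (box (to_ranked l) (to_ranked u))"
    by (simp add: emeasure_distr)
  also have "\<dots> = ennreal (\<Prod>b\<in>Basis. (to_ranked u - to_ranked l) \<bullet> b)"
    using le by (intro emeasure_lborel_box) (auto simp: Basis_vec_def inner_axis to_ranked_def)
  also have "(\<Prod>b\<in>Basis. (to_ranked u - to_ranked l) \<bullet> b) = (\<Prod>j\<in>UNIV. u $ unranked j - l $ unranked j)"
    by (simp add: Basis_vec_def prod.UNION_disjoint axis_eq_axis inner_axis to_ranked_def)
  also have "\<dots> = (\<Prod>b\<in>Basis. (u - l) \<bullet> b)"
    by (simp add: Basis_vec_def prod.UNION_disjoint axis_eq_axis inner_axis
        prod_ranked[of "\<lambda>i. u $ i - l $ i"])
  finally show "emeasure (distr lborel borel of_ranked) (box l u) = (\<Prod>b\<in>Basis. (u - l) \<bullet> b)" .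
qed simp

text \<open>Transport along \<open>Ranked\<close> is a sign-preserving bijection between the
  permutations of the two index types, so the Leibniz expansions agree term by term.\<close>

lemma det_ranked:
  fixes A :: "real^'n::finite^'n"
  shows "det (\<chi> i j. A $ unranked i $ unranked j) = det A"
proof -
  have inj: "inj Ranked" using bij_Ranked by (rule bij_is_inj)
  have bij: "bij_betw (map_permutation UNIV Ranked) {p. p permutes (UNIV :: 'n set)}
      {p. p permutes (UNIV :: 'n ranked set)}"
    using bij_betw_permutations[OF bij_Ranked]
    by (simp add: map_permutation_def[abs_def] restrict_id_def UNIV_ranked[symmetric] comp_def)
  have mp: "map_permutation UNIV Ranked p j = Ranked (p (unranked j))" for p :: "'n \<Rightarrow> 'n" and j
    by (simp add: map_permutation_def restrict_id_def UNIV_ranked[symmetric] inv_Ranked)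
  have "(\<Sum>p\<in>{p. p permutes (UNIV :: 'n ranked set)}.
          of_int (sign p) * (\<Prod>i\<in>UNIV. (\<chi> i j. A $ unranked i $ unranked j) $ i $ p i)) =
        (\<Sum>p\<in>{p. p permutes (UNIV :: 'n set)}. of_int (sign p) * (\<Prod>i\<in>UNIV. A $ i $ p i))"
    by (subst sum.reindex_bij_betw[OF bij, symmetric], rule sum.cong)
       (auto simp: sign_map_permutation inj mp prod_ranked[of "\<lambda>i. A $ i $ _ i"])
  then show ?thesis by (simp add: det_def)
qed

text \<open>\<open>has_measure_differentiable_image\<close> says that the image has finite measure
  \<open>m\<close> iff the Jacobian has gauge integral \<open>m\<close>. A case distinction on
  finiteness turns this into an identity of extended nonnegative numbers.\<close>

lemma emeasure_differentiable_image_wellorder: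
  fixes f :: "real^'n::{finite,wellorder} \<Rightarrow> real^'n::_"
  assumes S: "S \<in> sets borel" "f ` S \<in> sets borel"
    and der: "\<And>x. x \<in> S \<Longrightarrow> (f has_derivative f' x) (at x within S)" and inj: "inj_on f S"
    and meas: "(\<lambda>x. \<bar>det (matrix (f' x))\<bar> * indicator S x) \<in> borel_measurable borel"
  shows "emeasure lborel (f ` S) = (\<integral>\<^sup>+x\<in>S. ennreal \<bar>det (matrix (f' x))\<bar> \<partial>lborel)"
proof -
  let ?d = "\<lambda>x. \<bar>det (matrix (f' x))\<bar>"
  have iff: "f ` S \<in> lmeasurable \<and> measure lebesgue (f ` S) = m \<longleftrightarrow> (?d has_integral m) S" for m
    using S(1) by (intro has_measure_differentiable_image der inj) auto
  have nn: "(\<integral>\<^sup>+x\<in>S. ennreal (?d x) \<partial>lborel) = ennreal m" if "(?d has_integral m) S" for m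
    using that by (intro nn_integral_has_integral_lebesgue') auto
  show ?thesis
  proof (cases "f ` S \<in> lmeasurable")
    case True
    then have "emeasure lborel (f ` S) = ennreal (measure lebesgue (f ` S))"
      using S emeasure_eq_measure2[OF True] by (simp add: emeasure_completion)
    also have "\<dots> = (\<integral>\<^sup>+x\<in>S. ennreal (?d x) \<partial>lborel)"
      using iff[of "measure lebesgue (f ` S)"] True by (intro nn[symmetric]) simp
    finally show ?thesis .
  next
    case False
    \<comment> \<open>A finite value would make the Jacobian gauge integrable over \<open>S\<close>,
      and hence the image of finite measure.\<close>
    have "(\<integral>\<^sup>+x\<in>S. ennreal (?d x) \<partial>lborel) = \<infinity>"
    proof (rule ccontr)
      assume "\<not> ?thesis"
      then obtain m where m: "0 \<le> m" "(\<integral>\<^sup>+x\<in>S. ennreal (?d x) \<partial>lborel) = ennreal m"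
        by (cases "\<integral>\<^sup>+x\<in>S. ennreal (?d x) \<partial>lborel") auto
      have "(\<integral>\<^sup>+x. ennreal (?d x * indicator S x) \<partial>lborel) = ennreal m"
        unfolding m(2)[symmetric] by (rule nn_integral_cong) (auto simp: indicator_def)
      then have "((\<lambda>x. ?d x * indicator S x) has_integral m) UNIV"
        using meas m(1) by (intro nn_integral_has_integral) auto
      moreover have "(\<lambda>x. ?d x * indicator S x) = (\<lambda>x. if x \<in> S then ?d x else 0)"
        by (auto simp: indicator_def)
      ultimately have "(?d has_integral m) S" by (simp add: has_integral_restrict_UNIV)
      then show False using iff False by blast
    qed
    moreover have "emeasure lborel (f ` S) = \<infinity>"
      using False S(2) by (auto simp: fmeasurable_def not_less top_unique)
    ultimately show ?thesis by simp
  qed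
qed

text \<open>Conjugating \<open>f\<close> with the relabelling of coordinates moves the claim to a
  wellordered index type; neither Lebesgue measure nor the determinant changes.\<close>

lemma emeasure_differentiable_image:
  fixes f :: "real^'n::finite \<Rightarrow> real^'n"
  assumes S: "S \<in> sets borel" "f ` S \<in> sets borel"
    and der: "\<And>x. x \<in> S \<Longrightarrow> (f has_derivative f' x) (at x within S)" and inj: "inj_on f S"
    and meas: "(\<lambda>x. \<bar>det (matrix (f' x))\<bar> * indicator S x) \<in> borel_measurable borel"
  shows "emeasure lborel (f ` S) = (\<integral>\<^sup>+x\<in>S. ennreal \<bar>det (matrix (f' x))\<bar> \<partial>lborel)"
proof -
  define F F' T where "F = to_ranked \<circ> f \<circ> of_ranked"
    and "F' = (\<lambda>y. to_ranked \<circ> f' (of_ranked y) \<circ> of_ranked)" and "T = of_ranked -` S"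
  have T: "T \<in> sets borel"
    using measurable_sets_borel[OF borel_measurable_ranked(2) S(1)] by (simp add: T_def)
  have FT: "F ` T = of_ranked -` (f ` S)"
  proof safe
    fix y x assume "of_ranked y = f x" "x \<in> S"
    then have "y = F (to_ranked x)"
      using to_of_ranked[of y] by (simp add: F_def)
    then show "y \<in> F ` T" using \<open>x \<in> S\<close> by (auto simp: T_def)
  qed (auto simp: F_def T_def)
  have FTm: "F ` T \<in> sets borel"
    unfolding FT using measurable_sets_borel[OF borel_measurable_ranked(2) S(2)] by simp
  have im: "of_ranked ` T = S"
    unfolding T_def by (rule surj_image_vimage_eq) (rule surjI, rule of_to_ranked)
  have derF: "(F has_derivative F' y) (at y within T)" if "y \<in> T" for y
  proof -
    have "(of_ranked has_derivative of_ranked) (at y within T)"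
      using linear_of_ranked linear_imp_has_derivative by blast
    moreover have "(f has_derivative f' (of_ranked y)) (at (of_ranked y) within of_ranked ` T)"
      unfolding im using that by (intro der) (simp add: T_def)
    ultimately have "(f \<circ> of_ranked has_derivative f' (of_ranked y) \<circ> of_ranked) (at y within T)"
      by (rule diff_chain_within)
    from diff_chain_within[OF this linear_imp_has_derivative[OF linear_to_ranked]]
    show ?thesis by (simp add: F_def F'_def comp_assoc)
  qed
  have detF: "det (matrix (F' y)) = det (matrix (f' (of_ranked y)))" for y
    unfolding det_ranked[of "matrix (f' (of_ranked y))", symmetric]
    by (simp add: matrix_def F'_def of_ranked_axis) (simp add: to_ranked_def)
  have ind: "indicator T y = indicator S (of_ranked y)" for y
    by (simp add: T_def indicator_def)
  have "emeasure lborel (f ` S) = emeasure (distr lborel borel of_ranked) (f ` S)"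
    by (simp add: lborel_ranked)
  also have "\<dots> = emeasure lborel (F ` T)"
    using S by (simp add: emeasure_distr FT)
  also have "\<dots> = (\<integral>\<^sup>+x\<in>T. ennreal \<bar>det (matrix (F' x))\<bar> \<partial>lborel)"
  proof (rule emeasure_differentiable_image_wellorder[OF T FTm derF])
    show "inj_on F T"
    proof (rule inj_onI)
      fix x y assume "x \<in> T" "y \<in> T" "F x = F y"
      then have "of_ranked x \<in> S" "of_ranked y \<in> S" "f (of_ranked x) = f (of_ranked y)"
        by (auto simp: F_def T_def dest: arg_cong[of _ _ of_ranked])
      then have "of_ranked x = of_ranked y" using inj by (simp add: inj_on_eq_iff)
      then show "x = y" by (metis to_of_ranked)
    qed
    show "(\<lambda>x. \<bar>det (matrix (F' x))\<bar> * indicator T x) \<in> borel_measurable borel"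
      using measurable_compose[OF borel_measurable_ranked(2) meas] by (simp add: detF ind)
  qed
  also have "\<dots> = (\<integral>\<^sup>+y. ennreal (\<bar>det (matrix (f' (of_ranked y)))\<bar> * indicator S (of_ranked y)) \<partial>lborel)"
    by (rule nn_integral_cong) (simp add: detF T_def indicator_def)
  also have "\<dots> = (\<integral>\<^sup>+x. ennreal (\<bar>det (matrix (f' x))\<bar> * indicator S x) \<partial>distr lborel borel of_ranked)"
    using meas by (subst nn_integral_distr) auto
  also have "\<dots> = (\<integral>\<^sup>+x\<in>S. ennreal \<bar>det (matrix (f' x))\<bar> \<partial>lborel)"
    unfolding lborel_ranked by (rule nn_integral_cong) (simp add: indicator_def)
  finally show ?thesis .
qed

text \<open>By the preceding lemma, pushing the measure with density the Jacobian forward along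
  \<open>f\<close> gives Lebesgue measure restricted to the image, since the two agree on Borel
  sets. The formula is the integral of \<open>h\<close> against both.\<close>

lemma nn_integral_change_of_variables:
  fixes f :: "real^'n::finite \<Rightarrow> real^'n"
  assumes U: "open U" "open (f ` U)"
    and der: "\<And>x. x \<in> U \<Longrightarrow> (f has_derivative f' x) (at x)" and inj: "inj_on f U"
    and cont: "continuous_on U (\<lambda>x. det (matrix (f' x)))"
    and h: "h \<in> borel_measurable borel"
  shows "(\<integral>\<^sup>+y\<in>f ` U. h y \<partial>lborel) = (\<integral>\<^sup>+x\<in>U. ennreal \<bar>det (matrix (f' x))\<bar> * h (f x) \<partial>lborel)"
proof -
  let ?d = "\<lambda>x. \<bar>det (matrix (f' x))\<bar>"
  let ?R = "restrict_space lborel U"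
  have cf: "continuous_on U f"
    using der by (intro continuous_at_imp_continuous_on ballI has_derivative_continuous) blast
  have f: "f \<in> borel_measurable ?R"
    using borel_measurable_continuous_on_restrict[OF cf] by (simp cong: measurable_cong_sets add: sets_restrict_space)
  have d: "?d \<in> borel_measurable ?R"
    using borel_measurable_continuous_on_restrict[OF continuous_on_rabs[OF cont]]
    by (simp cong: measurable_cong_sets add: sets_restrict_space)
  have eq: "distr (density ?R ?d) borel f = density lborel (indicator (f ` U))" (is "?L = ?N")
  proof (rule measure_eqI)
    fix A assume "A \<in> sets (distr (density ?R ?d) borel f)"
    then have A: "A \<in> sets borel" by simp
    define S where "S = f -` A \<inter> U"
    have S: "S \<in> sets borel"
      using measurable_sets[OF f A] U(1) unfolding S_def
      by (simp add: space_restrict_space sets_restrict_space_iff)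
    have SU: "S \<subseteq> U" and fS: "f ` S = A \<inter> f ` U" by (auto simp: S_def)
    have "emeasure ?L A = emeasure (density ?R ?d) S"
      using f A by (subst emeasure_distr) (auto simp: S_def space_restrict_space)
    also have "\<dots> = (\<integral>\<^sup>+x\<in>S. ennreal (?d x) \<partial>?R)"
      using d S SU U(1) by (subst emeasure_density) (auto simp: sets_restrict_space_iff)
    also have "\<dots> = (\<integral>\<^sup>+x\<in>S. ennreal (?d x) \<partial>lborel)"
      using U(1) SU by (subst nn_integral_restrict_space) (auto intro!: nn_integral_cong simp: indicator_def)
    also have "\<dots> = emeasure lborel (f ` S)"
    proof (rule emeasure_differentiable_image[symmetric, OF S])
      show "f ` S \<in> sets borel" using fS A U(2) by auto
      show "inj_on f S" using inj SU by (rule inj_on_subset)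
      show "(f has_derivative f' x) (at x within S)" if "x \<in> S" for x
        using that SU der has_derivative_at_withinI by blast
      have "(\<lambda>x. ?d x * indicator U x) \<in> borel_measurable borel"
        using d U(1) by (subst (asm) borel_measurable_restrict_space_iff) (auto simp: mult.commute)
      then have "(\<lambda>x. ?d x * indicator U x * indicator S x) \<in> borel_measurable borel"
        using S by measurable
      moreover have "(\<lambda>x. ?d x * indicator U x * indicator S x) = (\<lambda>x. ?d x * indicator S x)"
        using SU by (auto simp: indicator_def fun_eq_iff)
      ultimately show "(\<lambda>x. ?d x * indicator S x) \<in> borel_measurable borel" by simp
    qed
    also have "\<dots> = emeasure ?N A"
      using A U(2) by (simp add: fS emeasure_density indicator_inter_arith[symmetric] Int_commute)
    finally show "emeasure ?L A = emeasure ?N A" .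
  qed simp
  have "(\<integral>\<^sup>+y\<in>f ` U. h y \<partial>lborel) = integral\<^sup>N ?N h"
    using h U(2) by (subst nn_integral_density) (auto simp: mult.commute)
  also have "\<dots> = integral\<^sup>N ?L h" by (simp add: eq)
  also have "\<dots> = (\<integral>\<^sup>+x. h (f x) \<partial>density ?R ?d)"
    using f h by (subst nn_integral_distr) auto
  also have "\<dots> = (\<integral>\<^sup>+x. ennreal (?d x) * h (f x) \<partial>?R)"
    using d f h by (subst nn_integral_density) auto
  also have "\<dots> = (\<integral>\<^sup>+x\<in>U. ennreal (?d x) * h (f x) \<partial>lborel)"
    using U(1) by (subst nn_integral_restrict_space) auto
  finally show ?thesis .
qed

section \<open>Smooth functions\<close>

text \<open>With \<open>U\<close> open, agreement on \<open>U\<close> is agreement near each of its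
  points, so the derivatives, which are taken in the whole space, coincide too.\<close>

lemma ck_on_cong:
  assumes "open U" "\<And>x. x \<in> U \<Longrightarrow> f x = g x" "ck_on k U f"
  shows "ck_on k U g"
  using assms(2,3)
proof (induction k arbitrary: f g)
  case 0
  then show ?case by (simp cong: continuous_on_cong)
next
  case (Suc k)
  have d: "f differentiable (at x)" if "x \<in> U" for x using Suc.prems(2) that by simp
  have "g differentiable (at x)" if "x \<in> U" for x
    using d[OF that] has_derivative_transform_within_open[of f _ x UNIV U g] assms(1) that Suc.prems(1)
    unfolding differentiable_def by blast
  moreover have "frechet_derivative f (at x) v = frechet_derivative g (at x) v" if "x \<in> U" for x v
    using frechet_derivative_transform_within_open[OF d assms(1) that Suc.prems(1)] that by simp
  then have "ck_on k U (\<lambda>x. frechet_derivative g (at x) v)" for v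
    using Suc.IH[of "\<lambda>x. frechet_derivative f (at x) v"] Suc.prems(2) by simp
  ultimately show ?case by simp
qed

lemma ck_on_SucD: "ck_on (Suc k) U f \<Longrightarrow> ck_on k U f"
proof (induction k arbitrary: f)
  case 0
  then show ?case
    by (auto intro!: continuous_at_imp_continuous_on differentiable_imp_continuous_within)
next
  case (Suc k)
  then show ?case by (metis ck_on.simps(2))
qed

lemma ck_on_const: "ck_on k U (\<lambda>x. c)"
  by (induction k arbitrary: c) simp_all

text \<open>Replaces the chosen \<open>frechet_derivative\<close> by an explicit formula, which is
  what the sum and product rules deliver.\<close>

lemma ck_on_SucI:
  assumes "open U" "\<And>x. x \<in> U \<Longrightarrow> (f has_derivative f' x) (at x)"
    and "\<And>v. ck_on k U (\<lambda>x. f' x v)"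
  shows "ck_on (Suc k) U f"
proof -
  have "frechet_derivative f (at x) = f' x" if "x \<in> U" for x
    using frechet_derivative_at[OF assms(2)[OF that]] by simp
  then have "ck_on k U (\<lambda>x. frechet_derivative f (at x) v)" for v
    by (intro ck_on_cong[OF assms(1) _ assms(3)[of v]]) simp
  moreover have "f differentiable (at x)" if "x \<in> U" for x
    using assms(2)[OF that] differentiable_def by blast
  ultimately show ?thesis by simp
qed

lemma ck_on_has_derivative:
  "ck_on (Suc k) U f \<Longrightarrow> x \<in> U \<Longrightarrow> (f has_derivative frechet_derivative f (at x)) (at x)"
  by (simp add: frechet_derivative_works)

lemma ck_on_add:
  assumes "open U" "ck_on k U f" "ck_on k U g"
  shows "ck_on k U (\<lambda>x. f x + g x)"
  using assms(2,3)
proof (induction k arbitrary: f g)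
  case 0
  then show ?case by (simp add: continuous_on_add)
next
  case (Suc k)
  show ?case
  proof (rule ck_on_SucI[OF assms(1)])
    fix x assume "x \<in> U"
    then show "((\<lambda>x. f x + g x) has_derivative
        (\<lambda>v. frechet_derivative f (at x) v + frechet_derivative g (at x) v)) (at x)"
      by (intro has_derivative_add ck_on_has_derivative[OF Suc.prems(1)] ck_on_has_derivative[OF Suc.prems(2)])
  next
    show "ck_on k U (\<lambda>x. frechet_derivative f (at x) v + frechet_derivative g (at x) v)" for v
      using Suc.prems by (intro Suc.IH) simp_all
  qed
qed

lemma ck_on_mult:
  fixes f g :: "'b::real_normed_vector \<Rightarrow> real"
  assumes "open U" "ck_on k U f" "ck_on k U g"
  shows "ck_on k U (\<lambda>x. f x * g x)"
  using assms(2,3)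
proof (induction k arbitrary: f g)
  case 0
  then show ?case by (simp add: continuous_on_mult)
next
  case (Suc k)
  show ?case
  proof (rule ck_on_SucI[OF assms(1)])
    fix x assume "x \<in> U"
    then show "((\<lambda>x. f x * g x) has_derivative
        (\<lambda>v. f x * frechet_derivative g (at x) v + frechet_derivative f (at x) v * g x)) (at x)"
      by (intro has_derivative_mult ck_on_has_derivative[OF Suc.prems(1)] ck_on_has_derivative[OF Suc.prems(2)])
  next
    \<comment> \<open>The Leibniz rule keeps one factor undifferentiated, so the factors themselves
      are needed at order \<open>k\<close>.\<close>
    have "ck_on k U f" "ck_on k U g" using Suc.prems by (auto intro: ck_on_SucD)
    then show "ck_on k U (\<lambda>x. f x * frechet_derivative g (at x) v + frechet_derivative f (at x) v * g x)" for v
      using Suc.prems by (intro ck_on_add assms(1) Suc.IH) simp_all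
  qed
qed

lemma smooth_on_const: "smooth_on U (\<lambda>x. c)"
  by (simp add: smooth_on_def ck_on_const)

lemma smooth_on_add: "open U \<Longrightarrow> smooth_on U f \<Longrightarrow> smooth_on U g \<Longrightarrow> smooth_on U (\<lambda>x. f x + g x)"
  by (simp add: smooth_on_def ck_on_add)

lemma smooth_on_mult:
  fixes f g :: "'b::real_normed_vector \<Rightarrow> real"
  shows "open U \<Longrightarrow> smooth_on U f \<Longrightarrow> smooth_on U g \<Longrightarrow> smooth_on U (\<lambda>x. f x * g x)"
  by (simp add: smooth_on_def ck_on_mult)

lemma smooth_on_continuous: "smooth_on U f \<Longrightarrow> continuous_on U f"
  unfolding smooth_on_def using ck_on.simps(1) by blast

lemma smooth_on_has_derivative:
  "smooth_on U f \<Longrightarrow> x \<in> U \<Longrightarrow> (f has_derivative frechet_derivative f (at x)) (at x)"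
  unfolding smooth_on_def using ck_on_has_derivative by blast

lemma smooth_on_continuous_det:
  fixes f :: "real^'n::finite \<Rightarrow> real^'n"
  assumes "smooth_on U f"
  shows "continuous_on U (\<lambda>x. det (matrix (frechet_derivative f (at x))))"
proof -
  have "continuous_on U (\<lambda>x. frechet_derivative f (at x) v)" for v
    using assms unfolding smooth_on_def by (metis ck_on.simps)
  then show ?thesis
    by (simp add: det_def matrix_def) (intro continuous_intros)
qed

section \<open>Calculus lemmas\<close>

text \<open>On the segment from the identity to \<open>A\<close> the quadratic form stays positive.
  If the determinant of \<open>A\<close> were not positive, the intermediate value theorem would
  give a singular matrix on the segment, and a kernel vector of it contradicts positivity.\<close>

lemma det_pos_of_posdef:
  fixes A :: "real^'n::finite^'n"
  assumes "\<And>v. v \<noteq> 0 \<Longrightarrow> v \<bullet> (A *v v) > 0"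
  shows "det A > 0"
proof (rule ccontr)
  let ?B = "\<lambda>t. (1 - t) *\<^sub>R mat 1 + t *\<^sub>R A"
  assume "\<not> det A > 0"
  then have "det (?B 1) \<le> 0" "0 \<le> det (?B 0)" by auto
  moreover have "continuous_on {0..1} (\<lambda>t. det (?B t))"
    by (simp add: det_def) (intro continuous_intros)
  ultimately obtain t where t: "0 \<le> t" "t \<le> 1" "det (?B t) = 0"
    using IVT2'[of "\<lambda>t. det (?B t)" 1 0 0] by auto
  then obtain v where v: "v \<noteq> 0" "?B t *v v = 0"
    using invertible_det_nz invertible_left_inverse matrix_left_invertible_ker by metis
  have "v \<bullet> (?B t *v v) = (1 - t) * (v \<bullet> v) + t * (v \<bullet> (A *v v))"
    by (simp add: matrix_vector_mult_add_rdistrib scaleR_matrix_vector_assoc[symmetric] inner_add_right)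
  moreover have "0 < v \<bullet> v" "0 < v \<bullet> (A *v v)" using v(1) assms by auto
  ultimately have "0 < v \<bullet> (?B t *v v)"
    using t by (cases "t = 0") (auto intro: add_nonneg_pos)
  then show False using v(2) by simp
qed

text \<open>The derivative is written in the form in which it enters the Euler-Lagrange equation. At
  0 it is the limit of a quotient of size \<open>\<bar>h\<bar> powr (q - 1)\<close>, which tends to
  0 because \<open>1 < q\<close>.\<close>

lemma has_real_derivative_abs_powr:
  fixes q x :: real
  assumes "1 < q \<or> x \<noteq> 0"
  shows "((\<lambda>x. \<bar>x\<bar> powr q) has_real_derivative q * (\<bar>x\<bar> powr (q - 2) * x)) (at x)"
proof (cases "x = 0")
  case False
  have "((\<lambda>x. \<bar>x\<bar>) has_real_derivative sgn x) (at x)"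
  proof (rule has_field_derivative_transform_within_open)
    show "((\<lambda>y. sgn x * y) has_real_derivative sgn x) (at x)"
      by (auto intro!: derivative_eq_intros)
    show "open (if 0 < x then {0<..} else {..<0::real})" by simp
  qed (use False in \<open>auto simp: sgn_if split: if_splits\<close>)
  then have "((\<lambda>x. \<bar>x\<bar> powr q) has_real_derivative q * \<bar>x\<bar> powr (q - 1) * sgn x) (at x)"
    using False by (intro DERIV_chain2[of "\<lambda>y. y powr q"] has_real_derivative_powr) auto
  moreover have "\<bar>x\<bar> powr (q - 1) = \<bar>x\<bar> powr (q - 2) * \<bar>x\<bar>"
    using False powr_add[of "\<bar>x\<bar>" "q - 2" 1] by simp
  ultimately show ?thesis by (simp add: abs_mult_sgn mult.assoc)
next
  case True
  with assms have "((\<lambda>h. \<bar>h\<bar> powr (q - 1)) \<longlongrightarrow> \<bar>0\<bar> powr (q - 1)) (at (0::real))"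
    by (intro tendsto_intros) auto
  then have lim: "((\<lambda>h. \<bar>h\<bar> powr (q - 1)) \<longlongrightarrow> 0) (at (0::real))" by simp
  have "((\<lambda>h. \<bar>h\<bar> powr q / h) \<longlongrightarrow> 0) (at (0::real))"
  proof (rule Lim_null_comparison[OF _ lim])
    show "\<forall>\<^sub>F h in at (0::real). norm (\<bar>h\<bar> powr q / h) \<le> \<bar>h\<bar> powr (q - 1)"
      by (auto simp: eventually_at_filter powr_diff)
  qed
  with True show ?thesis by (simp add: has_field_derivative_iff)
qed

text \<open>For \<open>q < 2\<close> the factor \<open>\<bar>x\<bar> powr (q - 2)\<close> blows up
  at 0, so continuity there cannot be read off factor by factor; the product has size
  \<open>\<bar>x\<bar> powr (q - 1)\<close>.\<close>

lemma continuous_on_abs_powr: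
  fixes q :: real
  assumes "1 < q \<or> 0 \<notin> A"
  shows "continuous_on A (\<lambda>x. q * (\<bar>x\<bar> powr (q - 2) * x))"
proof (intro continuous_at_imp_continuous_on ballI)
  fix x assume x: "x \<in> A"
  show "isCont (\<lambda>x. q * (\<bar>x\<bar> powr (q - 2) * x)) x"
  proof (cases "x = 0")
    case False
    then show ?thesis by (intro continuous_intros) auto
  next
    case True
    with assms x have "((\<lambda>h. \<bar>h\<bar> powr (q - 1)) \<longlongrightarrow> \<bar>0\<bar> powr (q - 1)) (at (0::real))"
      by (intro tendsto_intros) auto
    then have lim: "((\<lambda>h. \<bar>h\<bar> powr (q - 1)) \<longlongrightarrow> 0) (at (0::real))" by simp
    have "((\<lambda>h. \<bar>h\<bar> powr (q - 2) * h) \<longlongrightarrow> 0) (at (0::real))"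
    proof (rule Lim_null_comparison[OF _ lim])
      have "norm (\<bar>h\<bar> powr (q - 2) * h) = \<bar>h\<bar> powr (q - 1)" if "h \<noteq> 0" for h :: real
        using that powr_add[of "\<bar>h\<bar>" "q - 2" 1] by (simp add: abs_mult)
      then show "\<forall>\<^sub>F h in at (0::real). norm (\<bar>h\<bar> powr (q - 2) * h) \<le> \<bar>h\<bar> powr (q - 1)"
        by (auto simp: eventually_at_filter)
    qed
    then have "isCont (\<lambda>x. \<bar>x\<bar> powr (q - 2) * x) x" using True by (simp add: isCont_def)
    then show ?thesis by (rule continuous_mult_left)
  qed
qed

text \<open>The mean value theorem bounds the difference quotients by a constant, which is
  integrable, and dominated convergence along sequences gives the limit. The open set
  \<open>A\<close> leaves room for a \<open>\<phi>\<close> that is differentiable only off 0;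
  compactness of \<open>S\<close> keeps small perturbations of \<open>u\<close> inside
  \<open>A\<close>.\<close>

lemma (in finite_measure) has_real_derivative_integral_compose:
  fixes u v :: "'a \<Rightarrow> real" and \<phi> \<phi>' :: "real \<Rightarrow> real"
  assumes meas [measurable]: "u \<in> borel_measurable M" "v \<in> borel_measurable M"
      "\<phi> \<in> borel_measurable borel" "\<phi>' \<in> borel_measurable borel"
    and S: "compact S" "u ` space M \<subseteq> S" "S \<subseteq> A" and "open A"
    and B: "\<And>x. x \<in> space M \<Longrightarrow> \<bar>v x\<bar> \<le> B"
    and der: "\<And>y. y \<in> A \<Longrightarrow> (\<phi> has_real_derivative \<phi>' y) (at y)"
    and cont: "continuous_on A \<phi>'"
  shows "((\<lambda>t. \<integral>x. \<phi> (u x + t * v x) \<partial>M) has_real_derivative (\<integral>x. \<phi>' (u x) * v x \<partial>M)) (at 0)"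
proof -
  \<comment> \<open>A uniform margin around the range of \<open>u\<close>; half of it is used, so
    that closed balls still fit into \<open>A\<close>.\<close>
  obtain e where e: "0 < e" "(\<Union>y\<in>S. ball y e) \<subseteq> A"
    using compact_subset_open_imp_ball_epsilon_subset[OF S(1) \<open>open A\<close> S(3)] by blast
  define d where "d = e / 2"
  \<comment> \<open>A compact subset of \<open>A\<close> that contains \<open>u x + t * v x\<close>
    for all small \<open>t\<close>; the bounds on \<open>\<phi>\<close> and \<open>\<phi>'\<close>
    are taken over it.\<close>
  define K where "K = {y + h | y h. y \<in> S \<and> h \<in> cball 0 d}"
  have d: "0 < d" using e by (simp add: d_def)
  have K: "compact K" unfolding K_def by (intro compact_sums S compact_cball)
  have KA: "K \<subseteq> A"
  proof
    fix z assume "z \<in> K"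
    then obtain y h where "z = y + h" "y \<in> S" "\<bar>h\<bar> \<le> d" by (auto simp: K_def)
    then have "z \<in> ball y e" using e by (simp add: d_def dist_real_def)
    then show "z \<in> A" using e(2) \<open>y \<in> S\<close> by blast
  qed
  have cb: "cball (u x) d \<subseteq> K" if "x \<in> space M" for x
  proof
    fix z assume "z \<in> cball (u x) d"
    then have "z = u x + (z - u x) \<and> u x \<in> S \<and> z - u x \<in> cball 0 d"
      using S(2) that by (auto simp: dist_real_def)
    then show "z \<in> K" unfolding K_def by blast
  qed
  have contK: "continuous_on K \<phi>"
    using der KA by (intro continuous_at_imp_continuous_on ballI DERIV_isCont) blast
  obtain L where L: "\<And>y. y \<in> K \<Longrightarrow> \<bar>\<phi>' y\<bar> \<le> L"
    using compact_imp_bounded[OF compact_continuous_image[OF continuous_on_subset[OF cont KA] K]]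
    unfolding bounded_iff by auto
  obtain L0 where L0: "\<And>y. y \<in> K \<Longrightarrow> \<bar>\<phi> y\<bar> \<le> L0"
    using compact_imp_bounded[OF compact_continuous_image[OF contK K]] unfolding bounded_iff by auto
  have near: "u x + t * v x \<in> cball (u x) d" if "x \<in> space M" "\<bar>t\<bar> * B \<le> d" for x t
  proof -
    have "\<bar>t\<bar> * \<bar>v x\<bar> \<le> \<bar>t\<bar> * B" using B[OF that(1)] by (intro mult_left_mono) auto
    then show ?thesis using that(2) by (simp add: dist_real_def abs_mult)
  qed
  have int: "integrable M (\<lambda>x. \<phi> (u x + t * v x))" if "\<bar>t\<bar> * B \<le> d" for t
    by (rule integrable_const_bound[where B = L0]) (use near that cb L0 in \<open>fastforce\<close>, measurable)
  have lip: "\<bar>(\<phi> (u x + t * v x) - \<phi> (u x)) / t\<bar> \<le> L * B"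
    if "x \<in> space M" "\<bar>t\<bar> * B \<le> d" "t \<noteq> 0" for x t
  proof -
    have "norm (\<phi> (u x + t * v x) - \<phi> (u x)) \<le> L * norm (u x + t * v x - u x)"
    proof (rule field_differentiable_bound[of "cball (u x) d"])
      show "(\<phi> has_field_derivative \<phi>' z) (at z within cball (u x) d)" if "z \<in> cball (u x) d" for z
        using that cb[OF \<open>x \<in> space M\<close>] KA der by (blast intro: has_field_derivative_at_within)
      show "norm (\<phi>' z) \<le> L" if "z \<in> cball (u x) d" for z
        using that cb[OF \<open>x \<in> space M\<close>] L by auto
    qed (use near that d in auto)
    also have "\<dots> = \<bar>t\<bar> * (L * \<bar>v x\<bar>)" by (simp add: abs_mult)
    also have "\<dots> \<le> \<bar>t\<bar> * (L * B)"
    proof -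
      have "u x \<in> K" using cb[OF that(1)] d by auto
      then have "0 \<le> L" using L[of "u x"] by linarith
      then show ?thesis using B[OF that(1)] by (intro mult_left_mono) auto
    qed
    finally show ?thesis using that(3) by (simp add: abs_divide divide_le_eq mult.commute)
  qed
  have "((\<lambda>h. ((\<integral>x. \<phi> (u x + h * v x) \<partial>M) - (\<integral>x. \<phi> (u x) \<partial>M)) / h) \<longlongrightarrow> (\<integral>x. \<phi>' (u x) * v x \<partial>M)) (at 0)"
    unfolding tendsto_at_iff_sequentially
  proof (intro allI impI)
    fix X :: "nat \<Rightarrow> real"
    assume X0: "\<forall>i. X i \<in> UNIV - {0}" and X: "X \<longlonglongrightarrow> 0"
    have "(\<lambda>i. \<bar>X i\<bar> * B) \<longlonglongrightarrow> 0" using tendsto_mult_left_zero[OF tendsto_rabs_zero[OF X]] .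
    then have "\<forall>\<^sub>F i in sequentially. \<bar>X i\<bar> * B < d" using d by (rule order_tendstoD)
    \<comment> \<open>The bounds hold only for small parameters, so the sequence is shifted by
      \<open>N\<close> and shifted back at the end.\<close>
    then obtain N where N: "\<And>i. N \<le> i \<Longrightarrow> \<bar>X i\<bar> * B \<le> d"
      unfolding eventually_sequentially by (meson less_imp_le)
    have "(\<lambda>i. \<integral>x. (\<phi> (u x + X (i + N) * v x) - \<phi> (u x)) / X (i + N) \<partial>M)
        \<longlonglongrightarrow> (\<integral>x. \<phi>' (u x) * v x \<partial>M)"
    proof (rule integral_dominated_convergence[where w = "\<lambda>_. L * B"])
      show "AE x in M. (\<lambda>i. (\<phi> (u x + X (i + N) * v x) - \<phi> (u x)) / X (i + N)) \<longlonglongrightarrow> \<phi>' (u x) * v x"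
      proof (rule AE_I2)
        fix x assume x: "x \<in> space M"
        have "u x \<in> A" using S x by blast
        then have "((\<lambda>t. \<phi> (u x + t * v x)) has_real_derivative \<phi>' (u x) * v x) (at 0)"
          by (intro DERIV_chain2[of \<phi> _ "\<lambda>t. u x + t * v x"] der) (auto intro!: der derivative_eq_intros)
        then have "((\<lambda>h. (\<phi> (u x + h * v x) - \<phi> (u x)) / h) \<longlongrightarrow> \<phi>' (u x) * v x) (at 0)"
          by (simp add: has_field_derivative_iff)
        then have "(\<lambda>i. (\<phi> (u x + X i * v x) - \<phi> (u x)) / X i) \<longlonglongrightarrow> \<phi>' (u x) * v x"
          using X0 X unfolding tendsto_at_iff_sequentially comp_def by blast
        then show "(\<lambda>i. (\<phi> (u x + X (i + N) * v x) - \<phi> (u x)) / X (i + N)) \<longlonglongrightarrow> \<phi>' (u x) * v x"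
          by (rule LIMSEQ_ignore_initial_segment)
      qed
      show "AE x in M. norm ((\<phi> (u x + X (i + N) * v x) - \<phi> (u x)) / X (i + N)) \<le> L * B" for i
        using lip N[of "i + N"] X0 by (intro AE_I2) auto
    qed auto
    also have "(\<lambda>i. \<integral>x. (\<phi> (u x + X (i + N) * v x) - \<phi> (u x)) / X (i + N) \<partial>M) =
        (\<lambda>i. ((\<integral>x. \<phi> (u x + X (i + N) * v x) \<partial>M) - (\<integral>x. \<phi> (u x) \<partial>M)) / X (i + N))"
    proof
      fix i
      have "integrable M (\<lambda>x. \<phi> (u x + X (i + N) * v x))" "integrable M (\<lambda>x. \<phi> (u x))"
        using int[OF N[of "i + N"]] int[of 0] d by auto
      then show "(\<integral>x. (\<phi> (u x + X (i + N) * v x) - \<phi> (u x)) / X (i + N) \<partial>M) =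
          ((\<integral>x. \<phi> (u x + X (i + N) * v x) \<partial>M) - (\<integral>x. \<phi> (u x) \<partial>M)) / X (i + N)"
        by simp
    qed
    finally show "((\<lambda>h. ((\<integral>x. \<phi> (u x + h * v x) \<partial>M) - (\<integral>x. \<phi> (u x) \<partial>M)) / h) \<circ> X)
        \<longlonglongrightarrow> (\<integral>x. \<phi>' (u x) * v x \<partial>M)"
      unfolding comp_def by (rule LIMSEQ_offset)
  qed
  then show ?thesis by (simp add: has_field_derivative_iff)
qed

text \<open>Symmetry lets every slot be moved to the front, so linearity in the first slot suffices.\<close>

lemma has_real_derivative_symmetric_power:
  fixes L :: "('a \<Rightarrow> real) list \<Rightarrow> real"
  assumes sym: "\<And>us vs. length us = r \<Longrightarrow> set us \<subseteq> V \<Longrightarrow> mset vs = mset us \<Longrightarrow> L vs = L us"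
    and lin: "\<And>us t. Suc (length us) = r \<Longrightarrow> set us \<subseteq> V \<Longrightarrow>
      L ((\<lambda>p. u p + t * v p) # us) = L (u # us) + t * L (v # us)"
    and V: "u \<in> V" "v \<in> V" "\<And>t. (\<lambda>p. u p + t * v p) \<in> V"
    and "length us + i = r" "set us \<subseteq> V"
  shows "((\<lambda>t. L (us @ replicate i (\<lambda>p. u p + t * v p))) has_real_derivative
    real i * L (v # us @ replicate (i - 1) u)) (at 0)"
  using assms(6,7)
\<comment> \<open>The list \<open>us\<close> collects the slots already specialised to
  \<open>u\<close> or \<open>v\<close>; each step expands one of the \<open>i\<close> slots that
  still vary.\<close>
proof (induction i arbitrary: us)
  case 0
  then show ?case by simp
next
  case (Suc i)
  let ?w = "\<lambda>t p. u p + t * v p"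
  have expand: "L (us @ replicate (Suc i) (?w t)) =
      L ((u # us) @ replicate i (?w t)) + t * L ((v # us) @ replicate i (?w t))" for t
  proof -
    have "L (us @ replicate (Suc i) (?w t)) = L (?w t # us @ replicate i (?w t))"
      using Suc.prems V by (intro sym) auto
    then show ?thesis using Suc.prems V by (subst (asm) lin) auto
  qed
  have "((\<lambda>t. L ((u # us) @ replicate i (?w t)) + t * L ((v # us) @ replicate i (?w t)))
      has_real_derivative real i * L (v # (u # us) @ replicate (i - 1) u) +
      L ((v # us) @ replicate i (?w 0))) (at 0)"
    by (rule derivative_eq_intros Suc.IH | use Suc.prems V in simp)+
  moreover have "real i * L (v # (u # us) @ replicate (i - 1) u) = real i * L (v # us @ replicate i u)"
  \<comment> \<open>For \<open>i = 0\<close> the truncated \<open>i - 1\<close> is harmless, since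
    the factor \<open>real i\<close> vanishes.\<close>
  proof (cases i)
    case (Suc j)
    then have "L (v # (u # us) @ replicate (i - 1) u) = L (v # us @ replicate i u)"
      using Suc.prems V by (intro sym) auto
    then show ?thesis by simp
  qed simp
  ultimately show ?case
    by (simp only: expand) (simp add: add.commute distrib_right)
qed

section \<open>The Riemannian measure\<close>

text \<open>The assumption \<open>nonempty\<close> allows a countable cover by charts to be
  enumerated by all natural numbers.\<close>

locale riemannian =
  fixes M :: "('a, 'n::finite) chart set" and g :: "('a, 'n) metric_field"
  assumes riemannian: "riemannian_manifold M g" and nonempty: "points M \<noteq> {}"
begin

section \<open>Topology and Borel sets in charts\<close>

abbreviation borel_sets :: "'a measure" where
  "borel_sets \<equiv> sigma (points M) {W. openin (mtop M) W}"

abbreviation vol_density :: "('a, 'n) chart \<Rightarrow> real^'n \<Rightarrow> ennreal" where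
  "vol_density c x \<equiv> ennreal (sqrt (det (g c x)))"

lemma atlas: "smooth_atlas M" and metric: "riemannian_metric M g"
  using riemannian by (auto simp: riemannian_manifold_def smooth_manifold_def)

lemma chart_inj: "c \<in> M \<Longrightarrow> inj_on (snd c) (fst c)"
  and open_coord_dom: "c \<in> M \<Longrightarrow> open (coord_dom c)"
  and open_overlap: "c \<in> M \<Longrightarrow> c' \<in> M \<Longrightarrow> open (snd c ` (fst c \<inter> fst c'))"
  and smooth_transition:
    "c \<in> M \<Longrightarrow> c' \<in> M \<Longrightarrow> smooth_on (snd c ` (fst c \<inter> fst c')) (snd c' \<circ> chart_inv c)"
  using atlas unfolding smooth_atlas_def by blast+

lemma chart_inv_chart [simp]: "c \<in> M \<Longrightarrow> p \<in> fst c \<Longrightarrow> chart_inv c (snd c p) = p"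
  by (simp add: chart_inv_def chart_inj)

lemma chart_in_coord_dom [simp]: "p \<in> fst c \<Longrightarrow> snd c p \<in> coord_dom c"
  by (simp add: coord_dom_def)

lemma coord_domE:
  assumes "x \<in> coord_dom c" obtains p where "p \<in> fst c" "x = snd c p"
  using assms by (auto simp: coord_dom_def)

lemma chart_subset: "c \<in> M \<Longrightarrow> fst c \<subseteq> points M"
  by (auto simp: points_def)

lemma openin_chart: "c \<in> M \<Longrightarrow> openin (mtop M) (fst c)"
  using open_overlap chart_subset by (auto simp: openin_mtop[OF atlas] Int_commute)

lemma topspace_mtop: "topspace (mtop M) = points M"
proof -
  have "openin (mtop M) (points M)"
    unfolding points_def using openin_chart by (intro openin_Union) auto
  moreover have "W \<subseteq> points M" if "openin (mtop M) W" for W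
    using that by (simp add: openin_mtop[OF atlas])
  ultimately show ?thesis by (metis openin_subset openin_topspace subset_antisym)
qed

lemma chart_inv_vimage:
  "c \<in> M \<Longrightarrow> chart_inv c -` B \<inter> coord_dom c = snd c ` (B \<inter> fst c)"
  by (auto elim!: coord_domE)

text \<open>Openness must be tested in every chart \<open>c'\<close>. There the set is the preimage
  of \<open>Q\<close> under the transition map to \<open>c\<close>, which is continuous on the open
  overlap.\<close>

lemma openin_chart_inv_image:
  assumes c: "c \<in> M" and Q: "open Q" "Q \<subseteq> coord_dom c"
  shows "openin (mtop M) (chart_inv c ` Q)"
  unfolding openin_mtop[OF atlas]
proof (intro conjI ballI)
  have "chart_inv c ` Q \<subseteq> fst c" using Q c by (auto elim!: coord_domE dest!: subsetD)
  then show "chart_inv c ` Q \<subseteq> points M" using chart_subset[OF c] by blast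
  fix c' assume c': "c' \<in> M"
  have "snd c' ` (chart_inv c ` Q \<inter> fst c')
      = (snd c \<circ> chart_inv c') -` Q \<inter> snd c' ` (fst c' \<inter> fst c)"
  proof (intro equalityI subsetI)
    fix y assume "y \<in> snd c' ` (chart_inv c ` Q \<inter> fst c')"
    then obtain x where x: "x \<in> Q" "chart_inv c x \<in> fst c'" "y = snd c' (chart_inv c x)" by blast
    moreover obtain p where "p \<in> fst c" "x = snd c p" using x(1) Q(2) coord_domE by blast
    ultimately show "y \<in> (snd c \<circ> chart_inv c') -` Q \<inter> snd c' ` (fst c' \<inter> fst c)"
      using c c' by auto
  next
    fix y assume "y \<in> (snd c \<circ> chart_inv c') -` Q \<inter> snd c' ` (fst c' \<inter> fst c)"
    then obtain p where p: "p \<in> fst c'" "p \<in> fst c" "y = snd c' p" "snd c p \<in> Q" using c' by auto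
    then have "p = chart_inv c (snd c p)" using c by simp
    then show "y \<in> snd c' ` (chart_inv c ` Q \<inter> fst c')" using p by blast
  qed
  then show "open (snd c' ` (chart_inv c ` Q \<inter> fst c'))"
    using continuous_open_preimage[OF smooth_on_continuous[OF smooth_transition[OF c' c]]
        open_overlap[OF c' c] Q(1)]
    by (simp add: Int_commute)
qed

lemma space_borel_sets [simp]: "space borel_sets = points M"
  by (simp add: space_measure_of_conv)

lemma opens_Pow: "{W. openin (mtop M) W} \<subseteq> Pow (points M)"
  using openin_subset topspace_mtop by blast

lemma openin_borel_sets: "openin (mtop M) W \<Longrightarrow> W \<in> sets borel_sets"
  using opens_Pow by (auto simp: sets_measure_of intro: sigma_sets.Basic)

lemma chart_borel_sets: "c \<in> M \<Longrightarrow> fst c \<in> sets borel_sets"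
  by (intro openin_borel_sets openin_chart)

lemma measurable_chart_inv:
  assumes c: "c \<in> M"
  shows "chart_inv c \<in> measurable (restrict_space lborel (coord_dom c)) borel_sets"
proof (rule measurable_measure_of[OF opens_Pow])
  show "chart_inv c \<in> space (restrict_space lborel (coord_dom c)) \<rightarrow> points M"
    using c chart_subset[OF c] by (auto simp: space_restrict_space elim!: coord_domE)
  fix W assume "W \<in> {W. openin (mtop M) W}"
  then have "open (snd c ` (W \<inter> fst c))" using c by (auto simp: openin_mtop[OF atlas])
  moreover have "snd c ` (W \<inter> fst c) \<subseteq> coord_dom c" by auto
  ultimately show "chart_inv c -` W \<inter> space (restrict_space lborel (coord_dom c))
      \<in> sets (restrict_space lborel (coord_dom c))"
    using open_coord_dom[OF c]
    by (simp add: space_restrict_space chart_inv_vimage[OF c] sets_restrict_space_iff)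
qed

lemma chart_image_borel:
  assumes c: "c \<in> M" and B: "B \<in> sets borel_sets"
  shows "snd c ` (B \<inter> fst c) \<in> sets borel"
proof -
  have "chart_inv c -` B \<inter> space (restrict_space lborel (coord_dom c))
      \<in> sets (restrict_space lborel (coord_dom c))"
    by (rule measurable_sets[OF measurable_chart_inv[OF c] B])
  then show ?thesis
    using open_coord_dom[OF c]
    by (simp add: space_restrict_space chart_inv_vimage[OF c] sets_restrict_space_iff)
qed

section \<open>The volume in one chart and its independence of the chart\<close>

lemma continuous_on_det_metric:
  assumes "c \<in> M" shows "continuous_on (coord_dom c) (\<lambda>x. sqrt (det (g c x)))"
proof -
  have "smooth_on (coord_dom c) (g c)"
    using metric assms unfolding riemannian_metric_def by blast
  then have "continuous_on (coord_dom c) (g c)" by (rule smooth_on_continuous)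
  then show ?thesis unfolding det_def by (intro continuous_intros)
qed

lemma det_metric_pos: "c \<in> M \<Longrightarrow> x \<in> coord_dom c \<Longrightarrow> 0 < det (g c x)"
  using metric unfolding riemannian_metric_def by (intro det_pos_of_posdef) blast

lemma measurable_vol_density:
  assumes "c \<in> M"
  shows "vol_density c \<in> borel_measurable (restrict_space lborel (coord_dom c))"
  using borel_measurable_continuous_on_restrict[OF continuous_on_det_metric[OF assms]]
  by (simp cong: measurable_cong_sets add: sets_restrict_space)

text \<open>Pushing forward along \<open>chart_inv\<close> yields a measure on all Borel sets of the
  manifold, concentrated on one chart, so that countably many of them can be summed.\<close>

definition chart_measure :: "('a, 'n) chart \<Rightarrow> 'a measure" where
  "chart_measure c =
     distr (density (restrict_space lborel (coord_dom c)) (vol_density c)) borel_sets (chart_inv c)"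

lemma sets_chart_measure: "sets (chart_measure c) = sets borel_sets"
  by (simp add: chart_measure_def)

lemma emeasure_chart_measure:
  assumes c: "c \<in> M" and B: "B \<in> sets borel_sets" "B \<subseteq> fst c"
  shows "emeasure (chart_measure c) B = (\<integral>\<^sup>+x\<in>snd c ` B. vol_density c x \<partial>lborel)"
proof -
  have BB: "B \<inter> fst c = B" and sub: "snd c ` B \<subseteq> coord_dom c" using B(2) by auto
  have "emeasure (chart_measure c) B
      = emeasure (density (restrict_space lborel (coord_dom c)) (vol_density c)) (snd c ` B)"
    using measurable_chart_inv[OF c] B unfolding chart_measure_def
    by (subst emeasure_distr) (auto simp: space_restrict_space chart_inv_vimage[OF c] BB)
  also have "\<dots> = (\<integral>\<^sup>+x\<in>snd c ` B. vol_density c x \<partial>restrict_space lborel (coord_dom c))"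
    using measurable_vol_density[OF c] chart_image_borel[OF c B(1)] sub open_coord_dom[OF c]
    by (subst emeasure_density) (auto simp: BB sets_restrict_space_iff)
  also have "\<dots> = (\<integral>\<^sup>+x\<in>snd c ` B. vol_density c x \<partial>lborel)"
    using open_coord_dom[OF c] sub
    by (subst nn_integral_restrict_space)
      (auto intro!: nn_integral_cong simp: indicator_def image_subset_iff)
  finally show ?thesis .
qed

text \<open>Determinants in the tensor law produce the square of the Jacobian determinant, whose
  root is its absolute value.\<close>

lemma vol_density_transition:
  assumes c: "c \<in> M" "c' \<in> M" and x: "x \<in> snd c ` (fst c \<inter> fst c')"
  defines "f \<equiv> snd c' \<circ> chart_inv c"
  shows "vol_density c x
    = ennreal \<bar>det (matrix (frechet_derivative f (at x)))\<bar> * vol_density c' (f x)"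
proof -
  let ?J = "matrix (frechet_derivative f (at x))"
  have "g c x = transpose ?J ** g c' (f x) ** ?J"
    using metric c x unfolding riemannian_metric_def f_def Let_def by blast
  then have "det (g c x) = (det ?J)\<^sup>2 * det (g c' (f x))"
    by (simp add: det_mul det_transpose power2_eq_square)
  then show ?thesis by (simp add: real_sqrt_mult ennreal_mult'[symmetric])
qed

text \<open>Change of variables along the transition map. Since that formula is about open sets, it
  is applied to the whole overlap, and \<open>B\<close> enters through the indicator in the
  integrand \<open>h\<close>.\<close>

lemma chart_measures_agree:
  assumes c: "c \<in> M" "c' \<in> M" and B: "B \<in> sets borel_sets" "B \<subseteq> fst c \<inter> fst c'"
  shows "(\<integral>\<^sup>+x\<in>snd c ` B. vol_density c x \<partial>lborel) = (\<integral>\<^sup>+y\<in>snd c' ` B. vol_density c' y \<partial>lborel)"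
proof -
  define U f where "U = snd c ` (fst c \<inter> fst c')" and "f = snd c' \<circ> chart_inv c"
  define h where "h = (\<lambda>y. vol_density c' y * indicator (snd c' ` B) y)"
  have fU: "f ` U = snd c' ` (fst c' \<inter> fst c)"
    using c by (auto simp: f_def U_def image_iff)
  have sub: "snd c' ` B \<subseteq> coord_dom c'" "B \<inter> fst c' = B" using B by auto
  \<comment> \<open>The density is under control only on the coordinate domain; the extra indicator
    makes it globally measurable and is absorbed by that of the image of \<open>B\<close>.\<close>
  have "(\<lambda>y. vol_density c' y * indicator (coord_dom c') y) \<in> borel_measurable borel"
    using measurable_vol_density[OF c(2)] open_coord_dom[OF c(2)]
    by (subst (asm) borel_measurable_restrict_space_iff_ennreal) auto
  then have "(\<lambda>y. vol_density c' y * indicator (coord_dom c') y * indicator (snd c' ` B) y)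
      \<in> borel_measurable borel"
    using chart_image_borel[OF c(2) B(1)] unfolding sub(2) by measurable
  moreover have "(\<lambda>y. vol_density c' y * indicator (coord_dom c') y * indicator (snd c' ` B) y) = h"
    using sub by (auto simp: h_def indicator_def fun_eq_iff)
  ultimately have h: "h \<in> borel_measurable borel" by simp
  have f: "smooth_on U f" using smooth_transition[OF c] by (simp add: U_def f_def)
  have "(\<integral>\<^sup>+y\<in>snd c' ` B. vol_density c' y \<partial>lborel) = (\<integral>\<^sup>+y\<in>f ` U. h y \<partial>lborel)"
    using B(2) unfolding fU h_def by (intro nn_integral_cong) (auto simp: indicator_def)
  also have "\<dots> = (\<integral>\<^sup>+x\<in>U. ennreal \<bar>det (matrix (frechet_derivative f (at x)))\<bar> * h (f x) \<partial>lborel)"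
  proof (rule nn_integral_change_of_variables[OF _ _ _ _ _ h])
    show "open U" "open (f ` U)" unfolding fU using open_overlap c by (auto simp: U_def)
    show "inj_on f U"
    proof (rule inj_onI)
      fix x y assume "x \<in> U" "y \<in> U" "f x = f y"
      then show "x = y" using c chart_inj[OF c(2)] by (auto simp: U_def f_def inj_on_eq_iff)
    qed
  qed (use f in \<open>auto intro: smooth_on_has_derivative smooth_on_continuous_det\<close>)
  also have "\<dots> = (\<integral>\<^sup>+x\<in>snd c ` B. vol_density c x \<partial>lborel)"
  proof (rule nn_integral_cong)
    fix x :: "real^'n"
    show "ennreal \<bar>det (matrix (frechet_derivative f (at x)))\<bar> * h (f x) * indicator U x
        = vol_density c x * indicator (snd c ` B) x"
    proof (cases "x \<in> U")
      case True
      then obtain p where p: "p \<in> fst c" "p \<in> fst c'" "x = snd c p" by (auto simp: U_def)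
      then have "f x \<in> snd c' ` B \<longleftrightarrow> p \<in> B" "x \<in> snd c ` B \<longleftrightarrow> p \<in> B"
        using B(2) c chart_inj[OF c(1)] chart_inj[OF c(2)] inj_on_image_mem_iff[of "snd c" "fst c" p B]
          inj_on_image_mem_iff[of "snd c'" "fst c'" p B]
        by (auto simp: f_def)
      then show ?thesis
        using True vol_density_transition[OF c] by (auto simp: h_def U_def f_def indicator_def)
    next
      case False
      then show ?thesis using B(2) by (auto simp: U_def indicator_def)
    qed
  qed
  finally show ?thesis by simp
qed

section \<open>Existence and uniqueness of the Riemannian measure\<close>

definition is_volume :: "'a measure \<Rightarrow> bool" where
  "is_volume \<mu> \<longleftrightarrow> sets \<mu> = sets borel_sets \<and>
     (\<forall>c\<in>M. \<forall>B\<in>sets \<mu>. B \<subseteq> fst c \<longrightarrow> emeasure \<mu> B = (\<integral>\<^sup>+x\<in>snd c ` B. vol_density c x \<partial>lborel))"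

text \<open>A second countable space is Lindelof, so countably many chart domains suffice;
  subtracting the earlier ones makes the pieces disjoint. Each piece lies in one chart, where the
  volume is prescribed.\<close>

lemma countable_disjoint_cover:
  obtains C :: "nat \<Rightarrow> ('a, 'n) chart" and A :: "nat \<Rightarrow> 'a set"
  where "range C \<subseteq> M" "\<And>i. A i \<subseteq> fst (C i)" "range A \<subseteq> sets borel_sets" "disjoint_family A"
    "(\<Union>i. A i) = points M"
proof -
  have "second_countable (mtop M)"
    using riemannian by (auto simp: riemannian_manifold_def smooth_manifold_def)
  then have "Lindelof_space (mtop M)" by (rule second_countable_imp_Lindelof_space)
  moreover have "\<Union>(fst ` M) = topspace (mtop M)" by (auto simp: topspace_mtop points_def)
  moreover have "openin (mtop M) U" if "U \<in> fst ` M" for U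
    using that openin_chart by blast
  ultimately obtain \<V> where V: "countable \<V>" "\<V> \<subseteq> fst ` M" "\<Union>\<V> = points M"
    unfolding topspace_mtop[symmetric] by (metis Lindelof_spaceD)
  then have "\<V> \<noteq> {}" using nonempty by auto
  define W where "W = from_nat_into \<V>"
  have W: "range W = \<V>"
    unfolding W_def using \<open>\<V> \<noteq> {}\<close> V(1) by (rule range_from_nat_into)
  define C where "C i = (SOME c. c \<in> M \<and> fst c = W i)" for i
  have "C i \<in> M \<and> fst (C i) = W i" for i
  proof -
    have "W i \<in> fst ` M" using W V(2) by blast
    then have "\<exists>c. c \<in> M \<and> fst c = W i" by force
    then show ?thesis unfolding C_def by (rule someI_ex)
  qed
  then have C: "C i \<in> M" "fst (C i) = W i" for i by simp_all
  show thesis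
  proof (rule that[of C "disjointed W"])
    have "range W \<subseteq> sets borel_sets"
    proof (rule image_subsetI)
      show "W i \<in> sets borel_sets" for i using chart_borel_sets[OF C(1)[of i]] C(2) by simp
    qed
    then show "range (disjointed W) \<subseteq> sets borel_sets"
      by (rule sets.range_disjointed_sets)
    show "(\<Union>i. disjointed W i) = points M" using W V(3) by (simp add: UN_disjointed_eq)
    show "disjointed W i \<subseteq> fst (C i)" for i using disjointed_subset[of W i] C(2)[of i] by simp
  qed (use C disjoint_family_disjointed in auto)
qed

text \<open>The measure is the sum of the chart measures of the pieces. Agreement on overlaps shows
  that it has the right value in every chart, also in those not selected for the cover. Uniqueness
  is countable additivity over the pieces.\<close>

lemma ex1_volume: "\<exists>!\<mu>. is_volume \<mu>"
proof -
  obtain C :: "nat \<Rightarrow> ('a, 'n) chart" and A where C: "range C \<subseteq> M"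
    and A: "\<And>i. A i \<subseteq> fst (C i)" "range A \<subseteq> sets borel_sets" "disjoint_family A"
      "(\<Union>i. A i) = points M"
    by (rule countable_disjoint_cover) (rule that)
  have CM: "C i \<in> M" and As: "A i \<in> sets borel_sets" for i using C A(2) by auto
  define m where "m B = (\<Sum>i. emeasure (chart_measure (C i)) (B \<inter> A i))" for B
  define \<mu> where "\<mu> = measure_of (points M) (sets borel_sets) m"
  have split: "(\<Sum>i. emeasure \<nu> (B \<inter> A i)) = emeasure \<nu> B"
    if "sets \<nu> = sets borel_sets" "B \<in> sets borel_sets" for \<nu> B
  proof -
    have "(\<Sum>i. emeasure \<nu> (B \<inter> A i)) = emeasure \<nu> (\<Union>i. B \<inter> A i)"
      using that As by (intro suminf_emeasure disjoint_family_subset[OF A(3)]) auto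
    also have "(\<Union>i. B \<inter> A i) = B" using A(4) sets.sets_into_space[OF that(2)] by auto
    finally show ?thesis .
  qed
  have sets_mu: "sets \<mu> = sets borel_sets"
    using sets.space_closed[of borel_sets] by (simp add: \<mu>_def sets.sigma_sets_eq[of borel_sets, simplified])
  have emeasure_mu: "emeasure \<mu> B = m B" if "B \<in> sets borel_sets" for B
    unfolding \<mu>_def
  proof (rule emeasure_measure_of_sigma[OF _ _ _ that])
    show "sigma_algebra (points M) (sets borel_sets)"
      using sets.sigma_algebra_axioms[of borel_sets] by simp
    show "positive (sets borel_sets) m" by (simp add: positive_def m_def)
    show "countably_additive (sets borel_sets) m"
    proof (rule countably_additiveI)
      fix F :: "nat \<Rightarrow> 'a set"
      assume F: "range F \<subseteq> sets borel_sets" "disjoint_family F"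
      \<comment> \<open>The double series is exchanged by reading the outer sum as an integral over
        counting measure.\<close>
      have "(\<Sum>j. m (F j)) = (\<integral>\<^sup>+i. (\<Sum>j. emeasure (chart_measure (C i)) (F j \<inter> A i)) \<partial>count_space UNIV)"
        by (subst nn_integral_suminf) (simp_all add: m_def nn_integral_count_space_nat)
      also have "\<dots> = (\<integral>\<^sup>+i. emeasure (chart_measure (C i)) (\<Union>(range F) \<inter> A i) \<partial>count_space UNIV)"
      proof (rule nn_integral_cong)
        fix i
        have "(\<Sum>j. emeasure (chart_measure (C i)) (F j \<inter> A i))
            = emeasure (chart_measure (C i)) (\<Union>j. F j \<inter> A i)"
          using F(1) As by (intro suminf_emeasure disjoint_family_subset[OF F(2)])
            (auto simp: sets_chart_measure)
        then show "(\<Sum>j. emeasure (chart_measure (C i)) (F j \<inter> A i))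
            = emeasure (chart_measure (C i)) (\<Union>(range F) \<inter> A i)" by simp
      qed
      finally show "(\<Sum>j. m (F j)) = m (\<Union>(range F))"
        by (simp add: m_def nn_integral_count_space_nat)
    qed
  qed
  have "is_volume \<mu>"
    unfolding is_volume_def
  proof (intro conjI ballI impI)
    show "sets \<mu> = sets borel_sets" by (rule sets_mu)
    fix c B assume c: "c \<in> M" and B: "B \<in> sets \<mu>" "B \<subseteq> fst c"
    \<comment> \<open>On each piece of \<open>B\<close> the selected chart may be traded for
      \<open>c\<close>, after which the pieces add up to \<open>B\<close> under one measure.\<close>
    have "emeasure (chart_measure (C i)) (B \<inter> A i) = emeasure (chart_measure c) (B \<inter> A i)" for i
    proof -
      have BA: "B \<inter> A i \<in> sets borel_sets" "B \<inter> A i \<subseteq> fst (C i)" "B \<inter> A i \<subseteq> fst c"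
        using B As[of i] sets_mu A(1)[of i] by auto
      then have "emeasure (chart_measure (C i)) (B \<inter> A i)
          = (\<integral>\<^sup>+x\<in>snd (C i) ` (B \<inter> A i). vol_density (C i) x \<partial>lborel)"
        by (intro emeasure_chart_measure CM)
      also have "\<dots> = (\<integral>\<^sup>+x\<in>snd c ` (B \<inter> A i). vol_density c x \<partial>lborel)"
        using BA by (intro chart_measures_agree CM c) auto
      also have "\<dots> = emeasure (chart_measure c) (B \<inter> A i)"
        using BA by (intro emeasure_chart_measure[symmetric] c)
      finally show ?thesis .
    qed
    then have "emeasure \<mu> B = emeasure (chart_measure c) B"
      using B sets_mu by (simp add: emeasure_mu m_def split sets_chart_measure)
    then show "emeasure \<mu> B = (\<integral>\<^sup>+x\<in>snd c ` B. vol_density c x \<partial>lborel)"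
      using B sets_mu by (simp add: emeasure_chart_measure c)
  qed
  moreover have "\<nu> = \<mu>" if \<nu>: "is_volume \<nu>" for \<nu>
  proof (rule measure_eqI)
    show "sets \<nu> = sets \<mu>" using \<nu> sets_mu by (simp add: is_volume_def)
    fix B assume "B \<in> sets \<nu>"
    then have B: "B \<in> sets borel_sets" using \<nu> by (simp add: is_volume_def)
    have "emeasure \<nu> (B \<inter> A i) = emeasure (chart_measure (C i)) (B \<inter> A i)" for i
    proof -
      have BA: "B \<inter> A i \<in> sets borel_sets" "B \<inter> A i \<subseteq> fst (C i)"
        using B As[of i] A(1)[of i] by auto
      then show ?thesis using \<nu> CM[of i] by (simp add: is_volume_def emeasure_chart_measure)
    qed
    then have "emeasure \<nu> B = m B"
      using split[OF _ B, of \<nu>] \<nu> by (simp add: is_volume_def m_def)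
    then show "emeasure \<nu> B = emeasure \<mu> B" using B by (simp add: emeasure_mu)
  qed
  ultimately show ?thesis by blast
qed

section \<open>Positivity on open sets and finiteness of the volume\<close>

abbreviation vol :: "'a measure" where
  "vol \<equiv> riem_volume M g"

lemma is_volume_vol: "is_volume vol"
proof -
  have "vol = (THE \<mu>. is_volume \<mu>)" by (simp add: riem_volume_def is_volume_def)
  then show ?thesis using theI'[OF ex1_volume] by simp
qed

lemma sets_vol: "sets vol = sets borel_sets"
  using is_volume_vol by (simp add: is_volume_def)

lemma space_vol [simp]: "space vol = points M"
  using sets_eq_imp_space_eq[OF sets_vol] by simp

lemma emeasure_vol:
  "c \<in> M \<Longrightarrow> B \<in> sets borel_sets \<Longrightarrow> B \<subseteq> fst c \<Longrightarrow>
    emeasure vol B = (\<integral>\<^sup>+x\<in>snd c ` B. vol_density c x \<partial>lborel)"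
  using is_volume_vol by (simp add: is_volume_def)

text \<open>In a chart around one of its points the set becomes a nonempty open set of coordinates,
  which is not Lebesgue null, and the density is positive there.\<close>

lemma emeasure_vol_open_pos:
  assumes W: "openin (mtop M) W" "W \<noteq> {}"
  shows "emeasure vol W \<noteq> 0"
proof
  assume 0: "emeasure vol W = 0"
  obtain p where p: "p \<in> W" using W by blast
  then have "p \<in> points M" using openin_subset[OF W(1)] by (auto simp: topspace_mtop)
  then obtain c where c: "c \<in> M" "p \<in> fst c" unfolding points_def by blast
  let ?B = "W \<inter> fst c"
  have B: "openin (mtop M) ?B" using W c openin_chart by blast
  have op: "open (snd c ` ?B)" using W c by (auto simp: openin_mtop[OF atlas])
  have sub: "snd c ` ?B \<subseteq> coord_dom c" by auto
  have "emeasure vol ?B \<le> emeasure vol W"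
    using W openin_borel_sets by (intro emeasure_mono) (auto simp: sets_vol)
  then have "(\<integral>\<^sup>+x\<in>snd c ` ?B. vol_density c x \<partial>lborel) = 0"
    using 0 emeasure_vol[OF c(1) openin_borel_sets[OF B]] by simp
  moreover have "(\<integral>\<^sup>+x\<in>snd c ` ?B. vol_density c x \<partial>lborel)
      = (\<integral>\<^sup>+x. vol_density c x * indicator (coord_dom c) x * indicator (snd c ` ?B) x \<partial>lborel)"
    using sub by (intro nn_integral_cong) (auto simp: indicator_def)
  moreover have "(\<lambda>x. vol_density c x * indicator (coord_dom c) x * indicator (snd c ` ?B) x)
      \<in> borel_measurable lborel"
    using measurable_vol_density[OF c(1)] open_coord_dom[OF c(1)] op
    by (subst (asm) borel_measurable_restrict_space_iff_ennreal) auto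
  ultimately have "AE x in lborel.
      vol_density c x * indicator (coord_dom c) x * indicator (snd c ` ?B) x = 0"
    by (simp add: nn_integral_0_iff_AE)
  then have "AE x in lborel. x \<notin> snd c ` ?B"
  proof (rule AE_mp, intro AE_I2 impI notI)
    fix x assume x: "vol_density c x * indicator (coord_dom c) x * indicator (snd c ` ?B) x = 0"
      "x \<in> snd c ` ?B"
    then have "x \<in> coord_dom c" using sub by blast
    then show False using x det_metric_pos[OF c(1), of x] by (auto simp: indicator_def)
  qed
  then have "snd c ` ?B \<in> null_sets lborel"
    using op by (subst (asm) AE_iff_null_sets[symmetric]) auto
  moreover have "snd c ` ?B \<noteq> {}" using p c by blast
  ultimately show False
    using op open_not_negligible negligible_iff_null_sets null_sets_completionI by blast
qed

text \<open>Every point has an open neighbourhood of finite volume, and finitely many of these cover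
  a compact manifold.\<close>

lemma finite_measure_vol:
  assumes "compact_space (mtop M)"
  shows "finite_measure vol"
proof -
  let ?\<U> = "{W. openin (mtop M) W \<and> emeasure vol W < \<infinity>}"
  have "p \<in> \<Union>?\<U>" if p: "p \<in> points M" for p
  proof -
    obtain c where c: "c \<in> M" "p \<in> fst c" using p unfolding points_def by blast
    then obtain r where r: "0 < r" "cball (snd c p) r \<subseteq> coord_dom c"
      using open_contains_cball open_coord_dom chart_in_coord_dom by metis
    \<comment> \<open>The closed ball bounds the continuous density; the open ball provides the
      neighbourhood.\<close>
    define Q where "Q = ball (snd c p) r"
    have Q: "open Q" "Q \<subseteq> cball (snd c p) r" "Q \<subseteq> coord_dom c"
      using r ball_subset_cball[of "snd c p" r] by (auto simp: Q_def)
    have W: "openin (mtop M) (chart_inv c ` Q)" by (rule openin_chart_inv_image[OF c(1) Q(1,3)])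
    have Wc: "chart_inv c ` Q \<subseteq> fst c" using Q(3) c by (auto elim!: coord_domE dest!: subsetD)
    have img: "snd c ` chart_inv c ` Q = Q"
    proof -
      have "snd c (chart_inv c x) = x" if "x \<in> Q" for x
        using subsetD[OF Q(3) that] c(1) by (auto elim!: coord_domE)
      then show ?thesis by (simp add: image_image)
    qed
    have "bounded ((\<lambda>x. sqrt (det (g c x))) ` cball (snd c p) r)"
      by (intro compact_imp_bounded compact_continuous_image compact_cball
          continuous_on_subset[OF continuous_on_det_metric[OF c(1)] r(2)])
    then obtain K where Kb: "\<forall>y\<in>(\<lambda>x. sqrt (det (g c x))) ` cball (snd c p) r. norm y \<le> K"
      unfolding bounded_iff by (rule exE)
    have K: "sqrt (det (g c x)) \<le> K" if "x \<in> cball (snd c p) r" for x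
    proof -
      have "norm (sqrt (det (g c x))) \<le> K" by (rule bspec[OF Kb imageI[OF that]])
      then show ?thesis unfolding real_norm_def by linarith
    qed
    have "emeasure vol (chart_inv c ` Q) = (\<integral>\<^sup>+x\<in>Q. vol_density c x \<partial>lborel)"
      using emeasure_vol[OF c(1) openin_borel_sets[OF W] Wc] by (simp add: img)
    also have "\<dots> \<le> (\<integral>\<^sup>+x\<in>cball (snd c p) r. ennreal K \<partial>lborel)"
      using K Q(2) by (intro nn_integral_mono) (auto simp: indicator_def intro!: ennreal_leI)
    also have "\<dots> < \<infinity>"
      using emeasure_lborel_cball_finite[of "snd c p" r]
      by (simp add: nn_integral_cmult_indicator ennreal_mult_less_top)
    finally have "chart_inv c ` Q \<in> ?\<U>" using W by simp
    moreover have "p \<in> chart_inv c ` Q"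
      using c r(1) by (intro image_eqI[of _ _ "snd c p"]) (auto simp: Q_def)
    ultimately show ?thesis by blast
  qed
  then have "topspace (mtop M) \<subseteq> \<Union>?\<U>" by (auto simp: topspace_mtop)
  then have "\<exists>F. finite F \<and> F \<subseteq> ?\<U> \<and> topspace (mtop M) \<subseteq> \<Union>F"
    using assms by (intro compactinD) (auto simp: compact_space_def)
  then obtain F where F: "finite F" "F \<subseteq> ?\<U>" "points M \<subseteq> \<Union>F"
    unfolding topspace_mtop by blast
  have "emeasure vol (points M) \<le> emeasure vol (\<Union>W\<in>F. W)"
    using F openin_borel_sets by (intro emeasure_mono) (auto simp: sets_vol)
  also have "\<dots> \<le> (\<Sum>W\<in>F. emeasure vol W)"
    using F openin_borel_sets by (intro emeasure_subadditive_finite) (auto simp: sets_vol)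
  also have "\<dots> < \<infinity>" using F(1,2) by (auto simp: less_top ennreal_sum_less_top)
  finally show ?thesis by (intro finite_measureI) simp
qed

section \<open>Smooth functions on the manifold\<close>

lemma continuous_map_smooth_fun:
  assumes "u \<in> smooth_fun M"
  shows "continuous_map (mtop M) euclideanreal u"
  unfolding continuous_map_def topspace_mtop
proof (intro conjI allI impI)
  fix V :: "real set" assume V: "openin euclideanreal V"
  show "openin (mtop M) {p \<in> points M. u p \<in> V}"
    unfolding openin_mtop[OF atlas]
  proof (intro conjI ballI)
    fix c assume c: "c \<in> M"
    have "continuous_on (coord_dom c) (u \<circ> chart_inv c)"
      using assms c by (intro smooth_on_continuous) (simp add: smooth_fun_def)
    then have "open (coord_dom c \<inter> (u \<circ> chart_inv c) -` V)"
      using V open_coord_dom[OF c] by (intro continuous_open_preimage) auto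
    moreover have "coord_dom c \<inter> (u \<circ> chart_inv c) -` V = snd c ` ({p \<in> points M. u p \<in> V} \<inter> fst c)"
      using c chart_subset[OF c] by (auto elim!: coord_domE)
    ultimately show "open (snd c ` ({p \<in> points M. u p \<in> V} \<inter> fst c))" by simp
  qed auto
qed auto

lemma measurable_continuous_map:
  assumes "continuous_map (mtop M) euclideanreal u"
  shows "u \<in> borel_measurable vol"
proof (rule borel_measurableI)
  fix V :: "real set" assume "open V"
  then have "openin (mtop M) {p \<in> points M. u p \<in> V}"
    using assms by (simp add: continuous_map_def topspace_mtop)
  then show "u -` V \<inter> space vol \<in> sets vol"
    unfolding sets_vol by (intro openin_borel_sets) (simp add: vimage_def Int_def conj_commute)
qed

lemma smooth_fun_const: "(\<lambda>p. c) \<in> smooth_fun M"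
  by (simp add: smooth_fun_def comp_def smooth_on_const)

lemma smooth_fun_add: "u \<in> smooth_fun M \<Longrightarrow> v \<in> smooth_fun M \<Longrightarrow> (\<lambda>p. u p + v p) \<in> smooth_fun M"
  unfolding smooth_fun_def comp_def by (auto intro!: smooth_on_add open_coord_dom)

lemma smooth_fun_mult: "u \<in> smooth_fun M \<Longrightarrow> v \<in> smooth_fun M \<Longrightarrow> (\<lambda>p. u p * v p) \<in> smooth_fun M"
  unfolding smooth_fun_def comp_def by (auto intro!: smooth_on_mult open_coord_dom)

text \<open>Polynomials arise from linear maps and constants by sums and products, so the algebra
  structure of the smooth functions replaces a chain rule.\<close>

lemma smooth_fun_polynomial:
  assumes "real_polynomial_function P" "u \<in> smooth_fun M"
  shows "(\<lambda>p. P (u p)) \<in> smooth_fun M"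
  using assms(1)
proof induction
  case (linear f)
  then obtain a where "f = (\<lambda>x. x * a)" by (auto simp: real_bounded_linear)
  then show ?case using smooth_fun_mult[OF assms(2) smooth_fun_const[of a]] by simp
qed (auto intro: smooth_fun_const smooth_fun_add smooth_fun_mult)

end

section \<open>Compact manifolds\<close>

locale compact_riemannian = riemannian +
  assumes compact_mtop: "compact_space (mtop M)"
begin

sublocale vol: finite_measure vol
  by (rule finite_measure_vol[OF compact_mtop])

lemma compact_image: "continuous_map (mtop M) euclideanreal f \<Longrightarrow> compact (f ` points M)"
  using image_compactin[of "mtop M" "points M" euclideanreal f] compact_mtop
  by (simp add: compact_space_def topspace_mtop)

lemma continuous_map_bounded:
  assumes "continuous_map (mtop M) euclideanreal f"
  obtains B where "\<And>p. p \<in> points M \<Longrightarrow> \<bar>f p\<bar> \<le> B"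
  using compact_imp_bounded[OF compact_image[OF assms]] unfolding bounded_iff by auto

lemma integrable_continuous_map:
  assumes "continuous_map (mtop M) euclideanreal f"
  shows "integrable vol f"
proof -
  obtain B where "\<And>p. p \<in> points M \<Longrightarrow> \<bar>f p\<bar> \<le> B"
    using continuous_map_bounded[OF assms] by blast
  then show ?thesis
    by (intro vol.integrable_const_bound[of _ B] AE_I2 measurable_continuous_map assms) simp
qed

lemma continuous_map_compose_on:
  assumes "continuous_map (mtop M) euclideanreal u" "continuous_on (u ` points M) \<phi>"
  shows "continuous_map (mtop M) euclideanreal (\<lambda>p. \<phi> (u p))"
proof -
  have "continuous_map (mtop M) (top_of_set (u ` points M)) u"
    using assms(1) by (auto simp: continuous_map_in_subtopology topspace_mtop)
  moreover have "continuous_map (top_of_set (u ` points M)) euclideanreal \<phi>"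
    using assms(2) by simp
  ultimately have "continuous_map (mtop M) euclideanreal (\<phi> \<circ> u)"
    by (rule continuous_map_compose)
  then show ?thesis by (simp add: comp_def)
qed

text \<open>If the integral were 0, then \<open>f\<close> would vanish almost everywhere, and the
  open set where it does not vanish would be null.\<close>

lemma integral_continuous_pos:
  assumes f: "continuous_map (mtop M) euclideanreal f" "\<And>p. p \<in> points M \<Longrightarrow> 0 \<le> f p"
    and p: "p \<in> points M" "f p \<noteq> 0"
  shows "0 < (\<integral>p. f p \<partial>vol)"
proof (rule ccontr)
  let ?W = "{p \<in> points M. f p \<in> - {0}}"
  have nn: "AE p in vol. 0 \<le> f p" using f(2) by (intro AE_I2) simp
  assume "\<not> ?thesis"
  then have "(\<integral>p. f p \<partial>vol) = 0" using integral_nonneg_AE[OF nn] by linarith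
  then have "AE p in vol. f p = 0"
    using integral_nonneg_eq_0_iff_AE[OF integrable_continuous_map[OF f(1)] nn] by simp
  moreover have W: "openin (mtop M) ?W"
    using openin_continuous_map_preimage[OF f(1), of "- {0}"]
    by (simp add: topspace_mtop open_Compl)
  moreover have "?W = {p \<in> space vol. \<not> f p = 0}" by auto
  ultimately have "emeasure vol ?W = 0"
    using openin_borel_sets[OF W] sets_vol by (simp add: AE_iff_measurable[of ?W])
  then show False using emeasure_vol_open_pos[OF W] p by blast
qed

text \<open>A closed set in a compact space is compact. This makes the symmetry of the Dirichlet
  form available for all smooth functions.\<close>

lemma smooth_fun_compact_supp_eq: "smooth_fun_compact_supp M = smooth_fun M"
  unfolding smooth_fun_compact_supp_def
  using closedin_compact_space[OF compact_mtop closedin_closure_of] by auto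

text \<open>A fundamental lemma of the calculus of variations. The natural test function
  \<open>h\<close> is only known to be continuous, because \<open>\<psi>\<close> is, so a smooth
  \<open>v\<close> uniformly close to it takes its place.\<close>

lemma eq_of_orthogonal_smooth:
  assumes w: "w \<in> smooth_fun M" and u: "u \<in> smooth_fun M"
    and \<psi>: "continuous_on (u ` points M) \<psi>"
    and orth: "\<And>v. v \<in> smooth_fun M \<Longrightarrow> (\<integral>p. v p * (w p - \<mu> * \<psi> (u p)) \<partial>vol) = 0"
    and p: "p \<in> points M"
  shows "w p = \<mu> * \<psi> (u p)"
proof (rule ccontr)
  define h where "h p = w p - \<mu> * \<psi> (u p)" for p
  note cont = continuous_map_smooth_fun[OF w] continuous_map_smooth_fun[OF u]
  have h: "continuous_map (mtop M) euclideanreal h"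
    unfolding h_def by (intro continuous_map_diff continuous_map_real_mult_left cont
        continuous_map_compose_on[OF cont(2) \<psi>])
  define I K where "I = (\<integral>p. h p * h p \<partial>vol)" and "K = \<bar>\<mu>\<bar> * (\<integral>p. \<bar>h p\<bar> \<partial>vol)"
  assume "w p \<noteq> \<mu> * \<psi> (u p)"
  then have "0 < I"
    unfolding I_def using p
    by (intro integral_continuous_pos[of _ p] continuous_map_real_mult[OF h h]) (auto simp: h_def)
  have K: "0 \<le> K" by (simp add: K_def)
  \<comment> \<open>Replacing one factor \<open>h\<close> by \<open>v\<close> changes
    \<open>I\<close> by at most \<open>e * K\<close>. This choice makes \<open>e * K\<close> less
    than \<open>I\<close>, and the summand 1 covers the case \<open>K = 0\<close>.\<close>
  define e where "e = I / (K + 1)"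
  have e: "0 < e" using \<open>0 < I\<close> K by (simp add: e_def)
  obtain P where P: "real_polynomial_function P" "\<And>x. x \<in> u ` points M \<Longrightarrow> \<bar>\<psi> x - P x\<bar> < e"
    using Stone_Weierstrass_real_polynomial_function[OF compact_image[OF cont(2)] \<psi> e] by blast
  define v where "v p = w p + - \<mu> * P (u p)" for p
  have v: "v \<in> smooth_fun M"
    unfolding v_def
    by (rule smooth_fun_add[OF w smooth_fun_mult[OF smooth_fun_const smooth_fun_polynomial[OF P(1) u]]])
  have diff: "h p - v p = \<mu> * (P (u p) - \<psi> (u p))" for p
    by (simp add: h_def v_def algebra_simps)
  have int: "integrable vol (\<lambda>p. h p * h p)" "integrable vol (\<lambda>p. v p * h p)"
      "integrable vol (\<lambda>p. \<bar>h p\<bar>)"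
    by (intro integrable_continuous_map continuous_map_real_mult continuous_map_real_abs h
        continuous_map_smooth_fun[OF v])+
  have "I = (\<integral>p. h p * h p \<partial>vol) - (\<integral>p. v p * h p \<partial>vol)"
    using orth[OF v] by (simp add: I_def h_def)
  also have "\<dots> = (\<integral>p. (h p - v p) * h p \<partial>vol)"
    using int by (simp add: left_diff_distrib)
  also have "\<dots> \<le> (\<integral>p. e * \<bar>\<mu>\<bar> * \<bar>h p\<bar> \<partial>vol)"
  proof (rule integral_mono)
    show "integrable vol (\<lambda>p. (h p - v p) * h p)" "integrable vol (\<lambda>p. e * \<bar>\<mu>\<bar> * \<bar>h p\<bar>)"
      using int by (simp_all add: left_diff_distrib)
    fix p assume "p \<in> space vol"
    then have "\<bar>P (u p) - \<psi> (u p)\<bar> \<le> e" using P(2)[of "u p"] by (force simp: abs_minus_commute)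
    then have "\<bar>\<mu>\<bar> * \<bar>P (u p) - \<psi> (u p)\<bar> * \<bar>h p\<bar> \<le> \<bar>\<mu>\<bar> * e * \<bar>h p\<bar>"
      by (intro mult_right_mono mult_left_mono) auto
    then have "\<bar>(h p - v p) * h p\<bar> \<le> e * \<bar>\<mu>\<bar> * \<bar>h p\<bar>"
      by (simp add: diff abs_mult mult.commute)
    then show "(h p - v p) * h p \<le> e * \<bar>\<mu>\<bar> * \<bar>h p\<bar>" by linarith
  qed
  also have "\<dots> = e * K" by (simp add: K_def)
  also have "\<dots> < e * (K + 1)" using e by simp
  also have "\<dots> = I" using K by (simp add: e_def)
  finally show False by simp
qed

end

section \<open>The functional\<close>

text \<open>The exponent is a parameter bound by \<open>q_eq\<close>, so that the calculus works
  with a single symbol.\<close>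

locale self_adjoint_operator = compact_riemannian M g
  for M :: "('a, 'n::finite) chart set" and g :: "('a, 'n) metric_field" +
  fixes D :: "('a, 'n) operator" and r k :: nat and q :: real
  assumes polydiff: "polydiff_op r D" and self_adjoint: "formally_self_adjoint r D"
    and noncritical: "real CARD('n) \<noteq> 2 * real k"
    and q_eq: "q = real r * real CARD('n) / (real CARD('n) - 2 * real k)"
begin

lemma rank_pos: "1 \<le> r"
  using polydiff by (simp add: polydiff_op_def)

lemma smooth_operator:
  "length us = r - 1 \<Longrightarrow> set us \<subseteq> smooth_fun M \<Longrightarrow> D M g us \<in> smooth_fun M"
  using polydiff riemannian unfolding polydiff_op_def multilinear_operator_def by blast

lemma q_nonzero: "q \<noteq> 0"
  using rank_pos noncritical by (simp add: q_eq)

lemma q_minus_2: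
  "q - 2 =
    ((real r - 2) * real CARD('n) + 4 * real k) / (real CARD('n) - 2 * real k)"
  using noncritical by (simp add: q_eq field_simps)

text \<open>For \<open>2 \<le> r\<close> the numerator is at least twice the dimension, while the
  denominator is at most the dimension; for \<open>r = 1\<close> the inequality comes from
  \<open>0 < k\<close>.\<close>

lemma q_gt_1:
  assumes "2 * k \<le> CARD('n)" "\<not> (r = 1 \<and> k = 0)"
  shows "1 < q"
proof -
  have "2 * real k < real CARD('n)" using assms(1) noncritical by linarith
  moreover have "real CARD('n) - 2 * real k < real r * real CARD('n)"
  proof (cases "r = 1")
    case False
    then have "2 \<le> real r" using rank_pos by linarith
    then have "2 * real CARD('n) \<le> real r * real CARD('n)" by (intro mult_right_mono) auto
    then show ?thesis using zero_less_card_finite[where 'a = 'n] by linarith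
  qed (use assms(2) in simp)
  ultimately show ?thesis by (simp add: q_eq)
qed

lemma dirichlet_form_sym:
  assumes "length us = r" "set us \<subseteq> smooth_fun M" "mset vs = mset us"
  shows "dirichlet_form D M g vs = dirichlet_form D M g us"
  using self_adjoint riemannian assms
  unfolding formally_self_adjoint_def smooth_fun_compact_supp_eq[symmetric] by blast

text \<open>The first function enters only as a factor of the integrand, so this is linearity of the
  integral, with integrability supplied by compactness.\<close>

lemma dirichlet_form_linear:
  assumes "Suc (length us) = r" "set us \<subseteq> smooth_fun M" "u \<in> smooth_fun M" "v \<in> smooth_fun M"
  shows "dirichlet_form D M g ((\<lambda>p. u p + t * v p) # us) =
    dirichlet_form D M g (u # us) + t * dirichlet_form D M g (v # us)"
proof -
  have "D M g us \<in> smooth_fun M" using assms by (intro smooth_operator) auto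
  then have "integrable vol (\<lambda>p. u p * D M g us p)" "integrable vol (\<lambda>p. v p * D M g us p)"
    using assms by (auto intro!: integrable_continuous_map continuous_map_smooth_fun smooth_fun_mult)
  then show ?thesis by (simp add: dirichlet_form_def distrib_right mult.assoc)
qed

lemma smooth_fun_line:
  "u \<in> smooth_fun M \<Longrightarrow> v \<in> smooth_fun M \<Longrightarrow> (\<lambda>p. u p + t * v p) \<in> smooth_fun M"
  by (intro smooth_fun_add smooth_fun_mult smooth_fun_const)

lemma has_real_derivative_dirichlet_form:
  assumes "u \<in> smooth_fun M" "v \<in> smooth_fun M"
  shows "((\<lambda>t. dirichlet_form D M g (replicate r (\<lambda>p. u p + t * v p))) has_real_derivative
    real r * (\<integral>p. v p * D M g (replicate (r - 1) u) p \<partial>vol)) (at 0)"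
proof -
  have "((\<lambda>t. dirichlet_form D M g ([] @ replicate r (\<lambda>p. u p + t * v p))) has_real_derivative
      real r * dirichlet_form D M g (v # [] @ replicate (r - 1) u)) (at 0)"
  proof (rule has_real_derivative_symmetric_power[where V = "smooth_fun M" and r = r])
    show "dirichlet_form D M g vs = dirichlet_form D M g us"
      if "length us = r" "set us \<subseteq> smooth_fun M" "mset vs = mset us" for us vs
      using that by (rule dirichlet_form_sym)
    show "dirichlet_form D M g ((\<lambda>p. u p + t * v p) # us) =
        dirichlet_form D M g (u # us) + t * dirichlet_form D M g (v # us)"
      if "Suc (length us) = r" "set us \<subseteq> smooth_fun M" for us t
      using that assms by (rule dirichlet_form_linear)
  qed (use assms in \<open>auto intro: smooth_fun_line\<close>)
  then show ?thesis by (simp add: dirichlet_form_def)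
qed

text \<open>The multiplier is explicit here; that no other one is possible is shown separately.
  Either alternative of \<open>nz\<close> keeps the values of \<open>u\<close> where
  \<open>\<bar>x\<bar> powr q\<close> is continuously differentiable.\<close>

lemma critical_point_iff:
  assumes u: "u \<in> nonzero_smooth_fun M"
    and nz: "1 < q \<or> (\<forall>p\<in>points M. u p \<noteq> 0)"
  defines "N \<equiv> \<integral>p. \<bar>u p\<bar> powr q \<partial>vol"
  shows "0 < N"
    and "critical_point M (functional r k D M g) u \<longleftrightarrow>
      (\<forall>p\<in>points M. D M g (replicate (r - 1) u) p =
        dirichlet_form D M g (replicate r u) / N * (\<bar>u p\<bar> powr (q - 2) * u p))"
proof -
  \<comment> \<open>\<open>A\<close> is where \<open>\<bar>x\<bar> powr q\<close> is known to be continuously differentiable.\<close>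
  define A :: "real set" where "A = (if 1 < q then UNIV else - {0})"
  define w \<psi> \<mu> where "w = D M g (replicate (r - 1) u)" and "\<psi> x = \<bar>x\<bar> powr (q - 2) * x"
    and "\<mu> = dirichlet_form D M g (replicate r u) / N" for x :: real
  have us: "u \<in> smooth_fun M" using u by (simp add: nonzero_smooth_fun_def)
  have w: "w \<in> smooth_fun M" unfolding w_def using us by (intro smooth_operator) auto
  note cu = continuous_map_smooth_fun[OF us] and cw = continuous_map_smooth_fun[OF w]
  have A: "open A" "u ` points M \<subseteq> A" using nz by (auto simp: A_def)
  have der: "((\<lambda>x. \<bar>x\<bar> powr q) has_real_derivative q * \<psi> x) (at x)" if "x \<in> A" for x
    unfolding \<psi>_def using that by (intro has_real_derivative_abs_powr) (auto simp: A_def split: if_splits)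
  have c\<psi>': "continuous_on A (\<lambda>x. q * \<psi> x)"
    unfolding \<psi>_def by (intro continuous_on_abs_powr) (auto simp: A_def)
  have q0: "q \<noteq> 0" by (rule q_nonzero)
  then have "continuous_on A \<psi>"
    using continuous_on_mult_left[OF c\<psi>', of "1 / q"] by simp
  then have c\<psi>: "continuous_on (u ` points M) \<psi>" using A(2) by (rule continuous_on_subset)
  have c\<phi>: "continuous_on (u ` points M) (\<lambda>x. \<bar>x\<bar> powr q)"
    by (intro continuous_at_imp_continuous_on ballI) (rule DERIV_isCont[OF der[OF subsetD[OF A(2)]]])
  obtain p0 where "p0 \<in> points M" "u p0 \<noteq> 0" using u by (auto simp: nonzero_smooth_fun_def)
  then show N: "0 < N"
    unfolding N_def by (intro integral_continuous_pos[of _ p0] continuous_map_compose_on[OF cu c\<phi>]) auto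
  have derF: "((\<lambda>t. functional r k D M g (\<lambda>p. u p + t * v p)) has_real_derivative
      real r / (N powr (1 / q)) ^ r * (\<integral>p. v p * (w p - \<mu> * \<psi> (u p)) \<partial>vol)) (at 0)"
    if v: "v \<in> smooth_fun M" for v
  proof -
    note cv = continuous_map_smooth_fun[OF v]
    obtain B where B: "\<And>p. p \<in> points M \<Longrightarrow> \<bar>v p\<bar> \<le> B" using continuous_map_bounded[OF cv] by blast
    define n where "n t = (\<integral>p. \<bar>u p + t * v p\<bar> powr q \<partial>vol)" for t
    define J where "J = (\<integral>p. \<psi> (u p) * v p \<partial>vol)"
    have n0: "n 0 = N" by (simp add: n_def N_def)
    have "(n has_real_derivative (\<integral>p. q * \<psi> (u p) * v p \<partial>vol)) (at 0)"
      unfolding n_def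
    proof (rule vol.has_real_derivative_integral_compose[where S = "u ` points M" and A = A and B = B])
      show "(\<lambda>x. q * \<psi> x) \<in> borel_measurable borel" unfolding \<psi>_def by measurable
      show "compact (u ` points M)" by (rule compact_image[OF cu])
    qed (use cu cv A B der c\<psi>' in \<open>auto intro: measurable_continuous_map\<close>)
    also have "(\<integral>p. q * \<psi> (u p) * v p \<partial>vol) = q * J"
      by (simp add: J_def mult.assoc)
    finally have dn: "(n has_real_derivative q * J) (at 0)" .
    have "((\<lambda>t. n t powr (1 / q)) has_real_derivative
        1 / q * N powr (1 / q - 1) * (q * J)) (at 0)"
      using N has_real_derivative_powr[of N "1 / q"]
      by (intro DERIV_chain2[of "\<lambda>x. x powr (1 / q)", OF _ dn]) (simp add: n0)
    \<comment> \<open>The factor \<open>q\<close> from differentiating under the integral cancels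
      the exponent \<open>1 / q\<close> of the norm; this works for negative \<open>q\<close>
      too.\<close>
    also have "1 / q * N powr (1 / q - 1) * (q * J) = N powr (1 / q) / N * J"
      using q0 N by (simp add: powr_diff)
    finally have dL: "((\<lambda>t. n t powr (1 / q)) has_real_derivative N powr (1 / q) / N * J) (at 0)" .
    define L where "L = N powr (1 / q)"
    have L: "0 < L" using N by (simp add: L_def)
    have "((\<lambda>t. (n t powr (1 / q)) ^ r) has_real_derivative
        real r * (L / N * J * L ^ (r - Suc 0))) (at 0)"
      using DERIV_power[OF dL, of r] by (simp add: n0 L_def)
    \<comment> \<open>Since \<open>r\<close> is positive, the spare factor \<open>L\<close> restores
      the full power from \<open>r - Suc 0\<close>.\<close>
    also have "real r * (L / N * J * L ^ (r - Suc 0)) = real r * L ^ r * J / N"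
      using rank_pos by (cases r) auto
    finally have dP: "((\<lambda>t. (n t powr (1 / q)) ^ r) has_real_derivative real r * L ^ r * J / N) (at 0)" .
    have "((\<lambda>t. dirichlet_form D M g (replicate r (\<lambda>p. u p + t * v p)) / (n t powr (1 / q)) ^ r)
        has_real_derivative
        ((real r * (\<integral>p. v p * w p \<partial>vol)) * L ^ r
          - dirichlet_form D M g (replicate r u) * (real r * L ^ r * J / N)) / (L ^ r * L ^ r)) (at 0)"
      using DERIV_divide[OF has_real_derivative_dirichlet_form[OF us v] dP] L
      by (simp add: n0 w_def L_def)
    also have "((real r * (\<integral>p. v p * w p \<partial>vol)) * L ^ r
          - dirichlet_form D M g (replicate r u) * (real r * L ^ r * J / N)) / (L ^ r * L ^ r)
        = real r / L ^ r * ((\<integral>p. v p * w p \<partial>vol) - \<mu> * J)"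
      using L N by (simp add: \<mu>_def field_simps)
    also have "(\<integral>p. v p * w p \<partial>vol) - \<mu> * J = (\<integral>p. v p * (w p - \<mu> * \<psi> (u p)) \<partial>vol)"
    proof -
      have "integrable vol (\<lambda>p. v p * w p)" "integrable vol (\<lambda>p. \<psi> (u p) * v p)"
        by (intro integrable_continuous_map continuous_map_real_mult cv cw
            continuous_map_compose_on[OF cu c\<psi>])+
      then show ?thesis by (simp add: J_def right_diff_distrib mult.left_commute mult.commute[of "v _"])
    qed
    finally show ?thesis
      by (simp add: functional_def Lp_norm_def n_def L_def q_eq)
  qed
  have "critical_point M (functional r k D M g) u \<longleftrightarrow>
      (\<forall>v\<in>smooth_fun M. (\<integral>p. v p * (w p - \<mu> * \<psi> (u p)) \<partial>vol) = 0)"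
  proof -
    have "((\<lambda>t. functional r k D M g (\<lambda>p. u p + t * v p)) has_real_derivative 0) (at 0) \<longleftrightarrow>
        (\<integral>p. v p * (w p - \<mu> * \<psi> (u p)) \<partial>vol) = 0" if "v \<in> smooth_fun M" for v
    proof
      assume "((\<lambda>t. functional r k D M g (\<lambda>p. u p + t * v p)) has_real_derivative 0) (at 0)"
      from DERIV_unique[OF derF[OF that] this] show "(\<integral>p. v p * (w p - \<mu> * \<psi> (u p)) \<partial>vol) = 0"
        using rank_pos N by simp
    qed (use derF[OF that] in simp)
    then show ?thesis using u by (simp add: critical_point_def)
  qed
  also have "\<dots> \<longleftrightarrow> (\<forall>p\<in>points M. w p = \<mu> * \<psi> (u p))"
  proof
    assume "\<forall>v\<in>smooth_fun M. (\<integral>p. v p * (w p - \<mu> * \<psi> (u p)) \<partial>vol) = 0"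
    then show "\<forall>p\<in>points M. w p = \<mu> * \<psi> (u p)"
      using eq_of_orthogonal_smooth[OF w us c\<psi>] by blast
  next
    assume eq: "\<forall>p\<in>points M. w p = \<mu> * \<psi> (u p)"
    have "(\<integral>p. v p * (w p - \<mu> * \<psi> (u p)) \<partial>vol) = (\<integral>p. 0 \<partial>vol)" for v
      by (rule Bochner_Integration.integral_cong) (use eq in auto)
    then show "\<forall>v\<in>smooth_fun M. (\<integral>p. v p * (w p - \<mu> * \<psi> (u p)) \<partial>vol) = 0" by simp
  qed
  finally show "critical_point M (functional r k D M g) u \<longleftrightarrow>
      (\<forall>p\<in>points M. D M g (replicate (r - 1) u) p =
        dirichlet_form D M g (replicate r u) / N * (\<bar>u p\<bar> powr (q - 2) * u p))"
    by (simp add: w_def \<mu>_def \<psi>_def)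
qed

lemma lagrange_multiplier:
  assumes "0 < (\<integral>p. \<bar>u p\<bar> powr q \<partial>vol)"
    and eq: "\<And>p. p \<in> points M \<Longrightarrow> D M g (replicate (r - 1) u) p = \<kappa> * (\<bar>u p\<bar> powr (q - 2) * u p)"
  shows "\<kappa> = dirichlet_form D M g (replicate r u) / (\<integral>p. \<bar>u p\<bar> powr q \<partial>vol)"
proof -
  \<comment> \<open>At 0 both sides are 0 whatever the sign of the exponents, because
    \<open>0 powr a = 0\<close>.\<close>
  have pow: "x * (\<bar>x\<bar> powr (q - 2) * x) = \<bar>x\<bar> powr q" for x :: real
  proof (cases "x = 0")
    case False
    then have "\<bar>x\<bar> powr q = \<bar>x\<bar> powr (q - 2) * \<bar>x\<bar>\<^sup>2"
      using powr_add[of "\<bar>x\<bar>" "q - 2" 2] by simp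
    then show ?thesis by (simp add: power2_eq_square)
  qed simp
  have "dirichlet_form D M g (replicate r u) = (\<integral>p. u p * D M g (replicate (r - 1) u) p \<partial>vol)"
    using rank_pos by (cases r) (auto simp: dirichlet_form_def)
  also have "\<dots> = (\<integral>p. \<kappa> * \<bar>u p\<bar> powr q \<partial>vol)"
  proof (rule Bochner_Integration.integral_cong)
    fix p assume "p \<in> space vol"
    then have "u p * D M g (replicate (r - 1) u) p = \<kappa> * (u p * (\<bar>u p\<bar> powr (q - 2) * u p))"
      by (simp only: eq space_vol mult.left_commute)
    then show "u p * D M g (replicate (r - 1) u) p = \<kappa> * \<bar>u p\<bar> powr q"
      unfolding pow .
  qed simp
  finally show ?thesis using assms(1) by simp
qed

end

theorem lemma1p2:
  fixes D :: "('a, 'n::finite) operator"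
    and M :: "('a, 'n) chart set" and g :: "('a, 'n) metric_field"
    and u :: "'a \<Rightarrow> real" and r k n :: nat
  assumes "n = CARD('n)"
    and "fsa_conf_cov_polydiff_op r D"
    and "has_homogeneity r D (- 2 * real k)"
    and "- 2 * real k \<noteq> - real n"
    and "riemannian_manifold M g" and "compact_space (mtop M)"
    and "u \<in> nonzero_smooth_fun M"
    and "n < 2 * k \<or> (r = 1 \<and> k = 0) \<Longrightarrow> \<forall>p\<in>points M. u p \<noteq> 0"
  shows "critical_point M (functional r k D M g) u \<longleftrightarrow>
    (\<exists>lam::real. \<forall>p\<in>points M.
       D M g (replicate (r - 1) u) p =
         ((real n - 2 * real k) / real r) ^ (r - 1) * lam *
         \<bar>u p\<bar> powr (((real r - 2) * real n + 4 * real k) / (real n - 2 * real k)) * u p)"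
proof -
  interpret self_adjoint_operator M g D r k "real r * real CARD('n) / (real CARD('n) - 2 * real k)"
    using assms by unfold_locales (auto simp: fsa_conf_cov_polydiff_op_def nonzero_smooth_fun_def)
  let ?q = "real r * real CARD('n) / (real CARD('n) - 2 * real k)"
  \<comment> \<open>A nonzero normalisation: dividing the multiplier by \<open>C\<close> passes
    between the stated form of the equation and the explicit one.\<close>
  define C where "C = ((real n - 2 * real k) / real r) ^ (r - 1)"
  have C: "C \<noteq> 0" using noncritical rank_pos assms(1) by (simp add: C_def)
  have nz: "1 < ?q \<or> (\<forall>p\<in>points M. u p \<noteq> 0)"
    using assms(1,8) q_gt_1 by fastforce
  note crit = critical_point_iff[OF assms(7) nz]
  have "critical_point M (functional r k D M g) u \<longleftrightarrow>
    (\<exists>lam. \<forall>p\<in>points M. D M g (replicate (r - 1) u) p = C * lam * (\<bar>u p\<bar> powr (?q - 2) * u p))"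
    (is "?L \<longleftrightarrow> (\<exists>lam. ?R lam)")
  proof
    assume ?L
    then have "?R (dirichlet_form D M g (replicate r u) / (\<integral>p. \<bar>u p\<bar> powr ?q \<partial>vol) / C)"
      using crit(2) C by simp
    then show "\<exists>lam. ?R lam" by blast
  next
    assume "\<exists>lam. ?R lam"
    then obtain lam where lam: "?R lam" by blast
    \<comment> \<open>An arbitrary multiplier must be the quotient of Dirichlet form and integral,
      which is the one in the criterion for critical points.\<close>
    then have "C * lam = dirichlet_form D M g (replicate r u) / (\<integral>p. \<bar>u p\<bar> powr ?q \<partial>vol)"
      by (intro lagrange_multiplier crit(1)) auto
    then show ?L using lam crit(2) by simp
  qed
  then show ?thesis
    unfolding q_minus_2 C_def assms(1) by (simp only: mult.assoc)
qed

end
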